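(* Let $\Omega\subseteq\mathbb{R}^d$ be nonempty, closed and convex, and let $U:\Omega\to\Omega$ be paramonotone and continuous on $\Omega$ with $\mathrm{Sol}(U,\Omega)\neq\emptyset$. Let $t_0\ge 0$, let $\alpha_0,\alpha_1,\delta:[t_0,\infty)\to(0,\infty)$ and $\lambda:[t_0,\infty)\to[0,\infty)$, and assume: (1) there exist constants $C_1,C_2>0$ such that $2\alpha_1(t)-2\delta(t)\lambda(t)-C_2\delta(t)\ge C_1$ for all $t\ge t_0$; (2) $\delta(t)<\frac14\left(\alpha_1(t)^2+2\alpha_1'(t)\right)$ for all $t\ge t_0$; (3) $\alpha_0$ and $\delta$ are locally integrable; (4) $\alpha_1,\delta,\lambda$ are locally absolutely continuous; (5) $\lambda$ is bounded above; (6) $\lambda(t)\gamma(t)\le 1$ for all $t\ge t_0$, where $\gamma:[t_0,\infty)\to\mathbb{R}$ is the solution of $\gamma'(t)+\alpha_1(t)\gamma(t)=\gamma(t)^2+\delta(t)$, $\gamma(t_0)=\frac14\alpha_1(t_0)$; (7) $\frac{d}{dt}\left[\alpha_1(t)-\delta(t)\lambda(t)\right]\le 0$ for all $t\ge t_0$; (8) $\int_{t_0}^\infty\delta(t)\alpha_0(t)^2\,dt<\infty$; (9) $\int_{t_0}^\infty\delta(t)\alpha_0(t)\,dt=\infty$. Let $x_0,x_1\in\Omega$ and suppose that the dynamical system $$x''(t)+\alpha_1(t)x'(t)=\delta(t)[y(t)-x(t)],\qquad x(t_0)=x_0,\quad x'(t_0)=\tfrac14\alpha_1(t_0)(x_1-x_0),$$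 $$y(t)=P_\Omega\left(x(t)+\lambda(t)x'(t)-\frac{\alpha_0(t)}{\max\{1,\|U(x(t)+\lambda(t)x'(t))\|\}}\,U(x(t)+\lambda(t)x'(t))\right)$$ admits a strong global solution $x:[t_0,\infty)\to\mathbb{R}^d$. Then: (i) $\|x''\|\in L^2$, i.e. $\int_{t_0}^\infty\|x''(t)\|^2\,dt<\infty$; (ii) $\lim_{t\to\infty}x'(t)=0$; (iii) there is $x_\star\in\mathrm{Sol}(U,\Omega)$ such that $\lim_{t\to\infty}x(t)=x_\star$.
   Context: $\langle\cdot,\cdot\rangle$ and $\|\cdot\|$ are the Euclidean inner product and norm on $\mathbb{R}^d$, and $P_\Omega$ is the metric projection onto $\Omega$. $\mathrm{Sol}(U,\Omega)$ is the set of $x_\star\in\Omega$ with $\langle U(x_\star),a-x_\star\rangle\ge 0$ for all $a\in\Omega$. $U$ is monotone if $\langle U(a)-U(b),a-b\rangle\ge 0$ for all $a,b\in\Omega$; $U$ is paramonotone if it is monotone and, for all $a,b\in\Omega$, $\langle U(a)-U(b),a-b\rangle=0$ if and only if $U(a)=U(b)$. A strong global solution is a function $x:[t_0,\infty)\to\mathbb{R}^d$ such that $x,x',x''$ are locally absolutely continuous (absolutely continuous on each compact interval), the differential equation holds for almost every $t\ge t_0$, and the initial conditions hold. Since $U$ is defined only on $\Omega$, the formula for $y(t)$ is understood with $x(t)+\lambda(t)x'(t)\in\Omega$, so that it makes sense. Condition (2) guarantees that the function $\gamma$ in (6) exists on all of $[t_0,\infty)$. *)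

theory Defs
  imports "HOL-Analysis.Analysis"
begin

definition Sol :: "('a::real_inner \<Rightarrow> 'a) \<Rightarrow> 'a set \<Rightarrow> 'a set" where
  "Sol U \<Omega> = {x \<in> \<Omega>. \<forall>a\<in>\<Omega>. U x \<bullet> (a - x) \<ge> 0}"

definition monotone_operator_on :: "'a::real_inner set \<Rightarrow> ('a \<Rightarrow> 'a) \<Rightarrow> bool" where
  "monotone_operator_on \<Omega> U \<longleftrightarrow> (\<forall>a\<in>\<Omega>. \<forall>b\<in>\<Omega>. (U a - U b) \<bullet> (a - b) \<ge> 0)"

definition paramonotone_on :: "'a::real_inner set \<Rightarrow> ('a \<Rightarrow> 'a) \<Rightarrow> bool" where
  "paramonotone_on \<Omega> U \<longleftrightarrow>
     monotone_operator_on \<Omega> U \<and>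
     (\<forall>a\<in>\<Omega>. \<forall>b\<in>\<Omega>. (U a - U b) \<bullet> (a - b) = 0 \<longleftrightarrow> U a = U b)"

text \<open>Absolute continuity of a function of one real variable (the constant
  \<^const>\<open>absolutely_continuous\<close> of the library is a relation between measures).
  The subintervals \<open>[l i, r i]\<close>, \<open>i < n\<close>, may share endpoints and may be degenerate.\<close>

definition abs_continuous_on_interval ::
    "real \<Rightarrow> real \<Rightarrow> (real \<Rightarrow> 'a::real_normed_vector) \<Rightarrow> bool" where
  "abs_continuous_on_interval a b f \<longleftrightarrow>
     (\<forall>\<epsilon>>0. \<exists>\<eta>>0. \<forall>(n::nat) l r.
        (\<forall>i<n. a \<le> l i \<and> l i \<le> r i \<and> r i \<le> b) \<longrightarrow>
        disjoint_family_on (\<lambda>i. {l i<..<r i}) {..<n} \<longrightarrow>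
        (\<Sum>i<n. r i - l i) < \<eta> \<longrightarrow>
        (\<Sum>i<n. norm (f (r i) - f (l i))) < \<epsilon>)"

definition locally_abs_continuous_from :: "real \<Rightarrow> (real \<Rightarrow> 'a::real_normed_vector) \<Rightarrow> bool" where
  "locally_abs_continuous_from t0 f \<longleftrightarrow>
     (\<forall>a b. t0 \<le> a \<longrightarrow> a \<le> b \<longrightarrow> abs_continuous_on_interval a b f)"

text \<open>\<^const>\<open>absolutely_integrable_on\<close> is Lebesgue integrability over a set.\<close>

definition locally_integrable_from :: "real \<Rightarrow> (real \<Rightarrow> real) \<Rightarrow> bool" where
  "locally_integrable_from t0 f \<longleftrightarrow>
     (\<forall>a b. t0 \<le> a \<longrightarrow> a \<le> b \<longrightarrow> f absolutely_integrable_on {a..b})"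

text \<open>Functions on \<open>[t0, \<infinity>)\<close> are rendered as functions on all reals whose values below
  \<open>t0\<close> are irrelevant, so derivatives are taken within \<open>{t0..}\<close>; at \<open>t0\<close> itself
  this is the right derivative.\<close>

definition riccati_solution ::
    "real \<Rightarrow> (real \<Rightarrow> real) \<Rightarrow> (real \<Rightarrow> real) \<Rightarrow> (real \<Rightarrow> real) \<Rightarrow> bool" where
  "riccati_solution t0 \<alpha>1 \<delta> \<gamma> \<longleftrightarrow>
     (\<forall>t\<ge>t0. \<exists>D. (\<gamma> has_real_derivative D) (at t within {t0..}) \<and>
        D + \<alpha>1 t * \<gamma> t = (\<gamma> t)\<^sup>2 + \<delta> t) \<and>
     \<gamma> t0 = \<alpha>1 t0 / 4"

text \<open>The value \<open>y(t)\<close> for \<open>z = x(t) + \<lambda>(t) x'(t)\<close> and \<open>c = \<alpha>0(t)\<close>; meaningful for \<open>z \<in> \<Omega>\<close>,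
  since only the values of \<open>U\<close> on \<open>\<Omega>\<close> are specified. On a nonempty closed convex set,
  \<^const>\<open>closest_point\<close> is the metric projection.\<close>

definition projected_step ::
    "('a::euclidean_space \<Rightarrow> 'a) \<Rightarrow> 'a set \<Rightarrow> real \<Rightarrow> 'a \<Rightarrow> 'a" where
  "projected_step U \<Omega> c z = closest_point \<Omega> (z - (c / max 1 (norm (U z))) *\<^sub>R U z)"

text \<open>The coefficient \<open>\<lambda>\<close> is written \<open>lam\<close>;
  the functions \<open>x'\<close> and \<open>x''\<close> are passed explicitly as \<open>xd\<close> and \<open>xdd\<close>; they are determined
  by \<open>x\<close> on \<open>{t0..}\<close>.\<close>

definition strong_global_solution ::
    "('a::euclidean_space \<Rightarrow> 'a) \<Rightarrow> 'a set \<Rightarrow> real \<Rightarrow>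
     (real \<Rightarrow> real) \<Rightarrow> (real \<Rightarrow> real) \<Rightarrow> (real \<Rightarrow> real) \<Rightarrow> (real \<Rightarrow> real) \<Rightarrow>
     'a \<Rightarrow> 'a \<Rightarrow> (real \<Rightarrow> 'a) \<Rightarrow> (real \<Rightarrow> 'a) \<Rightarrow> (real \<Rightarrow> 'a) \<Rightarrow> bool" where
  "strong_global_solution U \<Omega> t0 \<alpha>0 \<alpha>1 \<delta> lam x0 x1 x xd xdd \<longleftrightarrow>
     (\<forall>t\<ge>t0. (x has_vector_derivative xd t) (at t within {t0..})) \<and>
     (\<forall>t\<ge>t0. (xd has_vector_derivative xdd t) (at t within {t0..})) \<and>
     locally_abs_continuous_from t0 x \<and>
     locally_abs_continuous_from t0 xd \<and>
     locally_abs_continuous_from t0 xdd \<and>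
     (\<forall>t\<ge>t0. x t + lam t *\<^sub>R xd t \<in> \<Omega>) \<and>
     (AE t in lebesgue. t \<ge> t0 \<longrightarrow>
        xdd t + \<alpha>1 t *\<^sub>R xd t =
        \<delta> t *\<^sub>R (projected_step U \<Omega> (\<alpha>0 t) (x t + lam t *\<^sub>R xd t) - x t)) \<and>
     x t0 = x0 \<and>
     xd t0 = (\<alpha>1 t0 / 4) *\<^sub>R (x1 - x0)"

end

theory Submission
  imports Defs
begin

text \<open>Write \<open>w = \<alpha>1 - \<delta> \<lambda>\<close>, \<open>z = x + \<lambda> x'\<close> and \<open>f = x'' + w x' = \<delta> (y - z)\<close>. By (1) and (7), \<open>w\<close> is
  nonincreasing and bounded below by \<open>C1 / 2\<close>, and \<open>\<delta>\<close> is bounded. The projection inequality gives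
  \<open>\<parallel>f\<parallel> \<le> \<delta> \<alpha>0\<close>, so \<open>f\<close> is square integrable by (8); integrating \<open>\<parallel>f\<parallel>\<^sup>2\<close> by parts shows that \<open>x'\<close> and
  \<open>x''\<close> are square integrable, hence \<open>x' \<longlongrightarrow> 0\<close>. For a solution \<open>s\<close> and
  \<open>h = \<parallel>x - s\<parallel>\<^sup>2 / 2\<close>, the variational inequality of the projection gives
  \<open>h'' + w h' \<le> g - p\<close> with \<open>g\<close> integrable and
  \<open>p = \<delta> \<alpha>0 U(z) \<bullet> (z - s) / max 1 \<parallel>U(z)\<parallel> \<ge> 0\<close>. Hence \<open>h\<close> converges and \<open>p\<close> is integrable;
  by (9), \<open>U(z) \<bullet> (z - s)\<close> has lower limit \<open>0\<close>, so by paramonotonicity some cluster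
  point of \<open>z\<close>, equivalently of \<open>x\<close>, solves the variational inequality. The distance of
  \<open>x\<close> to that point converges, so its limit is \<open>0\<close>.\<close>

subsection \<open>Absolutely continuous functions\<close>

lemma abs_continuous_on_interval_imp_continuous_on:
  fixes f :: "real \<Rightarrow> 'a::real_normed_vector"
  assumes "abs_continuous_on_interval a b f"
  shows "continuous_on {a..b} f"
  unfolding continuous_on_iff
proof (intro ballI allI impI)
  fix s \<epsilon> :: real
  assume s: "s \<in> {a..b}" and "\<epsilon> > 0"
  with assms obtain \<eta> where "\<eta> > 0"
    and \<eta>: "\<And>(n::nat) l r. (\<forall>i<n. a \<le> l i \<and> l i \<le> r i \<and> r i \<le> b) \<Longrightarrow>
        disjoint_family_on (\<lambda>i. {l i<..<r i}) {..<n} \<Longrightarrow> (\<Sum>i<n. r i - l i) < \<eta> \<Longrightarrow>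
        (\<Sum>i<n. norm (f (r i) - f (l i))) < \<epsilon>"
    unfolding abs_continuous_on_interval_def by blast
  have "dist (f u) (f s) < \<epsilon>" if "u \<in> {a..b}" "dist u s < \<eta>" for u
  proof -
    \<comment> \<open>A family consisting of one interval; \<open>min\<close> and \<open>max\<close>
      cover both orders of \<open>u\<close> and \<open>s\<close>.\<close>
    have "norm (f (max u s) - f (min u s)) < \<epsilon>"
      using \<eta>[of 1 "\<lambda>_. min u s" "\<lambda>_. max u s"] that s
      by (auto simp: disjoint_family_on_def dist_real_def)
    then show ?thesis
      by (auto simp: dist_norm max_def min_def norm_minus_commute split: if_splits)
  qed
  with \<open>\<eta> > 0\<close> show "\<exists>d>0. \<forall>u\<in>{a..b}. dist u s < d \<longrightarrow> dist (f u) (f s) < \<epsilon>"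
    by blast
qed

lemma locally_abs_continuous_from_imp_continuous_on:
  fixes f :: "real \<Rightarrow> 'a::real_normed_vector"
  assumes "locally_abs_continuous_from t0 f"
  shows "continuous_on {t0..} f"
  unfolding continuous_on_iff
proof (intro ballI allI impI)
  fix s \<epsilon> :: real
  assume s: "s \<in> {t0..}" and "\<epsilon> > 0"
  \<comment> \<open>The unit margin, matched by the radius \<open>min d 1\<close> below, keeps
    nearby points in the compact interval.\<close>
  have "continuous_on {t0..s + 1} f"
    using assms s
    by (auto simp: locally_abs_continuous_from_def intro!: abs_continuous_on_interval_imp_continuous_on)
  then obtain d where "d > 0" and d: "\<And>u. u \<in> {t0..s + 1} \<Longrightarrow> dist u s < d \<Longrightarrow> dist (f u) (f s) < \<epsilon>"
    using s \<open>\<epsilon> > 0\<close> unfolding continuous_on_iff by force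
  have "dist (f u) (f s) < \<epsilon>" if "u \<in> {t0..}" "dist u s < min d 1" for u
    using that s by (intro d) (auto simp: dist_real_def)
  then show "\<exists>d>0. \<forall>u\<in>{t0..}. dist u s < d \<longrightarrow> dist (f u) (f s) < \<epsilon>"
    using \<open>d > 0\<close> by (intro exI[of _ "min d 1"]) auto
qed

text \<open>A common source for differences and products: the increment sums of \<open>f\<close> and
  \<open>g\<close> can each be made smaller than \<open>\<epsilon> / (2 * B)\<close>, and their
  weighted sum controls that of \<open>k\<close>.\<close>

lemma abs_continuous_on_interval_dominated:
  fixes f :: "real \<Rightarrow> 'a::real_normed_vector" and g :: "real \<Rightarrow> 'b::real_normed_vector"
    and k :: "real \<Rightarrow> 'c::real_normed_vector"
  assumes f: "abs_continuous_on_interval a b f" and g: "abs_continuous_on_interval a b g"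
    and B: "B > 0"
    and k: "\<And>s t. s \<in> {a..b} \<Longrightarrow> t \<in> {a..b} \<Longrightarrow>
      norm (k t - k s) \<le> B * norm (f t - f s) + B * norm (g t - g s)"
  shows "abs_continuous_on_interval a b k"
  unfolding abs_continuous_on_interval_def
proof (intro allI impI)
  fix \<epsilon> :: real
  assume "\<epsilon> > 0"
  then have "\<epsilon> / (2 * B) > 0" using B by simp
  note pos = this
  obtain \<eta>1 where \<eta>1: "\<eta>1 > 0" and 1: "\<And>(n::nat) l r. (\<forall>i<n. a \<le> l i \<and> l i \<le> r i \<and> r i \<le> b) \<Longrightarrow>
      disjoint_family_on (\<lambda>i. {l i<..<r i}) {..<n} \<Longrightarrow> (\<Sum>i<n. r i - l i) < \<eta>1 \<Longrightarrow>
      (\<Sum>i<n. norm (f (r i) - f (l i))) < \<epsilon> / (2 * B)"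
    using f pos unfolding abs_continuous_on_interval_def by blast
  obtain \<eta>2 where \<eta>2: "\<eta>2 > 0" and 2: "\<And>(n::nat) l r. (\<forall>i<n. a \<le> l i \<and> l i \<le> r i \<and> r i \<le> b) \<Longrightarrow>
      disjoint_family_on (\<lambda>i. {l i<..<r i}) {..<n} \<Longrightarrow> (\<Sum>i<n. r i - l i) < \<eta>2 \<Longrightarrow>
      (\<Sum>i<n. norm (g (r i) - g (l i))) < \<epsilon> / (2 * B)"
    using g pos unfolding abs_continuous_on_interval_def by blast
  show "\<exists>\<eta>>0. \<forall>(n::nat) l r. (\<forall>i<n. a \<le> l i \<and> l i \<le> r i \<and> r i \<le> b) \<longrightarrow>
      disjoint_family_on (\<lambda>i. {l i<..<r i}) {..<n} \<longrightarrow> (\<Sum>i<n. r i - l i) < \<eta> \<longrightarrow>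
      (\<Sum>i<n. norm (k (r i) - k (l i))) < \<epsilon>"
  proof (intro exI[of _ "min \<eta>1 \<eta>2"] conjI allI impI)
    show "min \<eta>1 \<eta>2 > 0" using \<eta>1 \<eta>2 by simp
    fix n :: nat and l r
    assume lr: "\<forall>i<n. a \<le> l i \<and> l i \<le> r i \<and> r i \<le> b"
      and disj: "disjoint_family_on (\<lambda>i. {l i<..<r i}) {..<n}"
      and len: "(\<Sum>i<n. r i - l i) < min \<eta>1 \<eta>2"
    have "(\<Sum>i<n. norm (k (r i) - k (l i)))
        \<le> (\<Sum>i<n. B * norm (f (r i) - f (l i)) + B * norm (g (r i) - g (l i)))"
      using lr by (intro sum_mono k) (auto intro: order_trans)
    also have "\<dots> = B * (\<Sum>i<n. norm (f (r i) - f (l i))) + B * (\<Sum>i<n. norm (g (r i) - g (l i)))"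
      by (simp add: sum.distrib sum_distrib_left)
    also have "\<dots> < B * (\<epsilon> / (2 * B)) + B * (\<epsilon> / (2 * B))"
      using 1[OF lr disj] 2[OF lr disj] len B by (intro add_strict_mono mult_strict_left_mono) auto
    also have "\<dots> = \<epsilon>" using B by (simp add: field_simps)
    finally show "(\<Sum>i<n. norm (k (r i) - k (l i))) < \<epsilon>" .
  qed
qed

lemma abs_continuous_on_interval_diff:
  assumes "abs_continuous_on_interval a b f" "abs_continuous_on_interval a b g"
  shows "abs_continuous_on_interval a b (\<lambda>t. f t - g t)"
proof (rule abs_continuous_on_interval_dominated[OF assms, of 1])
  fix s t
  show "norm (f t - g t - (f s - g s)) \<le> 1 * norm (f t - f s) + 1 * norm (g t - g s)"
    using norm_triangle_ineq4[of "f t - f s" "g t - g s"] by (simp add: algebra_simps)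
qed simp

lemma abs_continuous_on_interval_mult:
  fixes f g :: "real \<Rightarrow> real"
  assumes f: "abs_continuous_on_interval a b f" and g: "abs_continuous_on_interval a b g"
  shows "abs_continuous_on_interval a b (\<lambda>t. f t * g t)"
proof -
  have "bounded (f ` {a..b} \<union> g ` {a..b})"
    using f g by (simp add: abs_continuous_on_interval_imp_continuous_on
        compact_continuous_image compact_imp_bounded)
  then obtain B where B: "B > 0" "\<And>t. t \<in> {a..b} \<Longrightarrow> \<bar>f t\<bar> \<le> B" "\<And>t. t \<in> {a..b} \<Longrightarrow> \<bar>g t\<bar> \<le> B"
    unfolding bounded_pos by auto
  show ?thesis
  proof (rule abs_continuous_on_interval_dominated[OF f g \<open>B > 0\<close>])
    fix s t
    assume st: "s \<in> {a..b}" "t \<in> {a..b}"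
    have "\<bar>f t * g t - f s * g s\<bar> = \<bar>g t * (f t - f s) + f s * (g t - g s)\<bar>"
      by (simp add: algebra_simps)
    also have "\<dots> \<le> \<bar>g t\<bar> * \<bar>f t - f s\<bar> + \<bar>f s\<bar> * \<bar>g t - g s\<bar>"
      by (metis abs_mult abs_triangle_ineq)
    also have "\<dots> \<le> B * \<bar>f t - f s\<bar> + B * \<bar>g t - g s\<bar>"
      using B st by (intro add_mono mult_right_mono) auto
    finally show "norm (f t * g t - f s * g s) \<le> B * norm (f t - f s) + B * norm (g t - g s)"
      by simp
  qed
qed

text \<open>Additivity of the measure. It bounds the total length of the intervals tagged in a null
  set by the measure of an open cover of that set.\<close>

lemma disjoint_intervals_length_le:
  fixes l r :: "nat \<Rightarrow> real"
  assumes disj: "disjoint_family_on (\<lambda>i. {l i<..<r i}) {..<n}"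
    and lr: "\<And>i. i < n \<Longrightarrow> l i \<le> r i" and sub: "\<And>i. i < n \<Longrightarrow> {l i<..<r i} \<subseteq> G"
    and G: "G \<in> lmeasurable"
  shows "(\<Sum>i<n. r i - l i) \<le> measure lebesgue G"
proof -
  have "(\<Sum>i<n. r i - l i) = (\<Sum>i<n. measure lebesgue {l i<..<r i})"
    using lr by (intro sum.cong) auto
  also have "\<dots> = measure lebesgue (\<Union>i<n. {l i<..<r i})"
    by (rule measure_finite_Union[symmetric]) (use disj lr in \<open>auto simp: image_subset_iff\<close>)
  also have "\<dots> \<le> measure lebesgue G"
    using sub G by (intro measure_mono_fmeasurable) auto
  finally show ?thesis .
qed

text \<open>A Cousin partition splits into intervals tagged at points of differentiability, on which the
  slope is at most \<open>\<epsilon>\<close>, and intervals tagged in the null set, whose total length is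
  small enough for absolute continuity to apply.\<close>

lemma abs_continuous_nonpos_derivative_imp_le:
  fixes f :: "real \<Rightarrow> real"
  assumes ac: "abs_continuous_on_interval a b f" and "a \<le> b"
    and deriv: "AE t in lebesgue. t \<in> {a..b} \<longrightarrow>
      (\<exists>D\<le>0. (f has_real_derivative D) (at t within {a..b}))"
  shows "f b \<le> f a"
proof -
  obtain N where N: "negligible N"
    and good: "\<And>t. t \<in> {a..b} \<Longrightarrow> t \<notin> N \<Longrightarrow> \<exists>D\<le>0. (f has_real_derivative D) (at t within {a..b})"
    using deriv unfolding eventually_ae_filter negligible_iff_null_sets by (fastforce simp del: atLeastAtMost_iff)
  have eps: "f b - f a \<le> \<epsilon> * (b - a) + \<epsilon>" if "\<epsilon> > 0" for \<epsilon>
  proof -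
    obtain \<eta> where "\<eta> > 0"
      and \<eta>: "\<And>(n::nat) l r. (\<forall>i<n. a \<le> l i \<and> l i \<le> r i \<and> r i \<le> b) \<Longrightarrow>
        disjoint_family_on (\<lambda>i. {l i<..<r i}) {..<n} \<Longrightarrow> (\<Sum>i<n. r i - l i) < \<eta> \<Longrightarrow>
        (\<Sum>i<n. norm (f (r i) - f (l i))) < \<epsilon>"
      using ac \<open>\<epsilon> > 0\<close> unfolding abs_continuous_on_interval_def by blast
    \<comment> \<open>Outer regularity for the null set \<open>N\<close>; removing \<open>N\<close>
      from the open set does not change its measure.\<close>
    obtain G where G: "N \<subseteq> G" "open G" "G \<in> lmeasurable" "measure lebesgue G < \<eta>"
    proof -
      have null: "N \<in> null_sets lebesgue" using N by (simp add: negligible_iff_null_sets)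
      then obtain T where T: "open T" "N \<subseteq> T" "T - N \<in> lmeasurable"
        "emeasure lebesgue (T - N) < ennreal \<eta>"
        using sets_lebesgue_outer_open[of N \<eta>] \<open>\<eta> > 0\<close> by blast
      then have "emeasure lebesgue T < ennreal \<eta>"
        using null emeasure_Diff_null_set[of N lebesgue T] by auto
      moreover from this T have "T \<in> lmeasurable"
        by (intro fmeasurableI) (auto simp: less_top[symmetric] top_unique intro: order.strict_trans)
      ultimately show ?thesis
        using T that \<open>\<eta> > 0\<close> by (metis emeasure_eq_measure2 ennreal_less_iff measure_nonneg)
    qed
    \<comment> \<open>The radius of the gauge at \<open>t\<close>. The slope bound is demanded only
      for intervals that straddle \<open>t\<close>, which is all that differentiability at
      \<open>t\<close> alone can provide.\<close>
    have "\<exists>d>0. (t \<in> N \<longrightarrow> ball t d \<subseteq> G) \<and> (t \<in> {a..b} - N \<longrightarrow>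
        (\<forall>u v. u \<in> ball t d \<longrightarrow> v \<in> ball t d \<longrightarrow> a \<le> u \<longrightarrow> u \<le> t \<longrightarrow> t \<le> v \<longrightarrow> v \<le> b \<longrightarrow>
          f v - f u \<le> \<epsilon> * (v - u)))" for t
    proof -
      consider "t \<in> N" | "t \<notin> N" "t \<in> {a..b}" | "t \<notin> N" "t \<notin> {a..b}" by blast
      then show ?thesis
      proof cases
        case 1
        then show ?thesis using G by (meson DiffD2 open_contains_ball subset_eq)
      next
        case 2
        then obtain D where "D \<le> 0" and D: "(f has_real_derivative D) (at t within {a..b})"
          using good by blast
        then have "(f has_derivative (\<lambda>s. s * D)) (at t within {a..b})"
          by (simp add: has_field_derivative_def mult_commute_abs)
        then obtain d where "d > 0" and d: "\<And>u. u \<in> {a..b} \<Longrightarrow> \<bar>u - t\<bar> < d \<Longrightarrow>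
            \<bar>f u - f t - (u - t) * D\<bar> \<le> \<epsilon> * \<bar>u - t\<bar>"
          unfolding has_derivative_within_alt using \<open>\<epsilon> > 0\<close> by (auto simp: real_norm_def)
        have "f v - f u \<le> \<epsilon> * (v - u)"
          if "u \<in> ball t d" "v \<in> ball t d" "a \<le> u" "u \<le> t" "t \<le> v" "v \<le> b" for u v
        proof -
          \<comment> \<open>The linear approximation on each side of the tag; the sum of the two
            errors is \<open>\<epsilon> * (v - u)\<close>.\<close>
          have "f v - f t - (v - t) * D \<le> \<epsilon> * (v - t)" "f t - f u + (u - t) * D \<le> \<epsilon> * (t - u)"
            using d[of u] d[of v] that by (auto simp: dist_real_def)
          moreover have "(v - t) * D \<le> 0" "0 \<le> (u - t) * D"
            using \<open>D \<le> 0\<close> that by (auto simp: mult_nonneg_nonpos mult_nonpos_nonpos)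
          ultimately show ?thesis by (simp add: algebra_simps)
        qed
        with 2 \<open>d > 0\<close> show ?thesis by blast
      next
        case 3
        then show ?thesis by (intro exI[of _ 1]) auto
      qed
    qed
    then obtain d where d: "\<And>t. d t > 0" "\<And>t. t \<in> N \<Longrightarrow> ball t (d t) \<subseteq> G"
      "\<And>t u v. t \<in> {a..b} - N \<Longrightarrow> u \<in> ball t (d t) \<Longrightarrow> v \<in> ball t (d t) \<Longrightarrow> a \<le> u \<Longrightarrow> u \<le> t \<Longrightarrow>
        t \<le> v \<Longrightarrow> v \<le> b \<Longrightarrow> f v - f u \<le> \<epsilon> * (v - u)"
      by metis
    have "gauge (\<lambda>t. ball t (d t))" using d(1) by (simp add: gauge_ball_dependent)
    then obtain p where p: "p tagged_division_of {a..b}" and fine: "(\<lambda>t. ball t (d t)) fine p"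
      using fine_division_exists_real by blast
    note pD = tagged_division_ofD[OF p]
    have K: "K = {Inf K..Sup K} \<and> a \<le> Inf K \<and> Inf K \<le> t \<and> t \<le> Sup K \<and> Sup K \<le> b \<and> K \<subseteq> ball t (d t)
        \<and> measure lborel K = Sup K - Inf K \<and> t \<in> {a..b}"
      if "(t, K) \<in> p" for t K
    proof -
      have tK: "t \<in> K" "K \<subseteq> {a..b}" and "\<exists>l r. K = cbox l r" using pD that by blast+
      then obtain l r where lr: "K = {l..r}" by auto
      moreover from this tK have "l \<le> r" by auto
      ultimately show ?thesis using tK fine that unfolding fine_def by auto
    qed
    define p1 where "p1 = {tK \<in> p. fst tK \<in> N}"
    have finp: "finite p" "finite p1" "p1 \<subseteq> p" using pD(1) by (auto simp: p1_def)
    have "f b - f a = (\<Sum>(t, K)\<in>p. f (Sup K) - f (Inf K))"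
      using additive_tagged_division_1[OF \<open>a \<le> b\<close> p, of f] by simp
    also have "\<dots> = (\<Sum>(t, K)\<in>p - p1. f (Sup K) - f (Inf K)) + (\<Sum>(t, K)\<in>p1. f (Sup K) - f (Inf K))"
      using finp by (simp add: sum.subset_diff)
    also have "(\<Sum>(t, K)\<in>p - p1. f (Sup K) - f (Inf K)) \<le> (\<Sum>(t, K)\<in>p - p1. \<epsilon> * measure lborel K)"
    proof (intro sum_mono, clarify)
      fix t K
      assume tK: "(t, K) \<in> p" "(t, K) \<notin> p1"
      note KK = K[OF tK(1)]
      then have "Inf K \<in> K" "Sup K \<in> K" by (metis atLeastAtMost_iff order_refl order_trans)+
      then have "f (Sup K) - f (Inf K) \<le> \<epsilon> * (Sup K - Inf K)"
        using tK KK by (intro d(3)[of t]) (auto simp: p1_def)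
      then show "f (Sup K) - f (Inf K) \<le> \<epsilon> * measure lborel K" using KK by simp
    qed
    also have "(\<Sum>(t, K)\<in>p - p1. \<epsilon> * measure lborel K) \<le> (\<Sum>(t, K)\<in>p. \<epsilon> * measure lborel K)"
      using finp \<open>\<epsilon> > 0\<close> by (intro sum_mono2) auto
    also have "\<dots> = \<epsilon> * (b - a)"
      using additive_content_tagged_division[of p a b] p \<open>a \<le> b\<close>
      by (simp add: sum_distrib_left[symmetric] case_prod_unfold)
    also have "(\<Sum>(t, K)\<in>p1. f (Sup K) - f (Inf K)) \<le> \<epsilon>"
    proof -
      \<comment> \<open>The intervals tagged in \<open>N\<close> are enumerated to match the indexed
        families in the definition of absolute continuity.\<close>
      obtain e where e: "bij_betw e {..<card p1} p1"
        using ex_bij_betw_nat_finite[OF finp(2)] by (auto simp: atLeast0LessThan)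
      define l where "l i = Inf (snd (e i))" for i
      define r where "r i = Sup (snd (e i))" for i
      have ei: "e i \<in> p1" if "i < card p1" for i using e that by (auto simp: bij_betw_def)
      have KI: "snd (e i) = {l i..r i} \<and> a \<le> l i \<and> l i \<le> r i \<and> r i \<le> b \<and>
          snd (e i) \<subseteq> ball (fst (e i)) (d (fst (e i)))" if "i < card p1" for i
        using K[of "fst (e i)" "snd (e i)"] ei[OF that] finp by (auto simp: l_def r_def)
      have disj: "disjoint_family_on (\<lambda>i. {l i<..<r i}) {..<card p1}"
        unfolding disjoint_family_on_def
      proof (intro ballI impI)
        fix i j
        assume ij: "i \<in> {..<card p1}" "j \<in> {..<card p1}" "i \<noteq> j"
        then have "e i \<noteq> e j" using e by (auto simp: bij_betw_def inj_on_def)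
        then have "interior (snd (e i)) \<inter> interior (snd (e j)) = {}"
          using pD(5)[of "fst (e i)" "snd (e i)" "fst (e j)" "snd (e j)"] ei ij finp(3)
          by (auto simp: prod_eq_iff)
        then show "{l i<..<r i} \<inter> {l j<..<r j} = {}" using KI ij by auto
      qed
      have "(\<Sum>i<card p1. r i - l i) \<le> measure lebesgue G"
      proof (rule disjoint_intervals_length_le[OF disj _ _ G(3)])
        fix i
        assume i: "i < card p1"
        show "l i \<le> r i" using KI i by blast
        have "{l i<..<r i} \<subseteq> snd (e i)" using KI[OF i] by auto
        also have "\<dots> \<subseteq> G" using KI[OF i] d(2)[of "fst (e i)"] ei[OF i] by (auto simp: p1_def)
        finally show "{l i<..<r i} \<subseteq> G" .
      qed
      then have "(\<Sum>i<card p1. norm (f (r i) - f (l i))) < \<epsilon>"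
        using \<eta>[of "card p1" l r] KI disj G(4) by force
      moreover have "(\<Sum>(t, K)\<in>p1. f (Sup K) - f (Inf K)) = (\<Sum>i<card p1. f (r i) - f (l i))"
        using sum.reindex_bij_betw[OF e, of "\<lambda>(t, K). f (Sup K) - f (Inf K)"]
        by (simp add: case_prod_unfold l_def r_def)
      moreover have "(\<Sum>i<card p1. f (r i) - f (l i)) \<le> (\<Sum>i<card p1. norm (f (r i) - f (l i)))"
        by (intro sum_mono) auto
      ultimately show ?thesis by linarith
    qed
    finally show ?thesis by simp
  qed
  have "f b - f a \<le> 0 + e" if "e > 0" for e
  proof -
    \<comment> \<open>The scaling makes the two error terms add up to exactly \<open>e\<close>, also
      when \<open>a = b\<close>.\<close>
    have "f b - f a \<le> e / (b - a + 1) * (b - a) + e / (b - a + 1)"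
      using that \<open>a \<le> b\<close> by (intro eps) auto
    also have "\<dots> = e / (b - a + 1) * (b - a + 1)" by (simp only: distrib_left mult_1_right)
    also have "\<dots> = e" using \<open>a \<le> b\<close> by simp
    finally show ?thesis by simp
  qed
  then have "f b - f a \<le> 0" by (rule field_le_epsilon)
  then show ?thesis by simp
qed

subsection \<open>Integrals over half-lines\<close>

lemma integral_mono_AE:
  fixes f g :: "'a::euclidean_space \<Rightarrow> real"
  assumes f: "f integrable_on S" and g: "g integrable_on S"
    and le: "AE t in lebesgue. t \<in> S \<longrightarrow> f t \<le> g t"
  shows "integral S f \<le> integral S g"
proof -
  obtain N where N: "negligible N" and fg: "\<And>t. t \<in> S \<Longrightarrow> t \<notin> N \<Longrightarrow> f t \<le> g t"
    using le unfolding eventually_ae_filter negligible_iff_null_sets by fastforce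
  \<comment> \<open>Altering \<open>f\<close> on the null set makes the inequality hold everywhere
    on \<open>S\<close> and leaves the integral unchanged.\<close>
  define k where "k t = (if t \<in> N then g t else f t)" for t
  have "k integrable_on S" "integral S k = integral S f"
    using integrable_spike[OF f N, of k] integral_spike[OF N, of S f k] by (auto simp: k_def)
  moreover have "integral S k \<le> integral S g"
    by (rule integral_le) (use \<open>k integrable_on S\<close> g fg in \<open>auto simp: k_def\<close>)
  ultimately show ?thesis by simp
qed

lemma antimono_bounded_below_tendsto:
  fixes f :: "real \<Rightarrow> real"
  assumes antimono: "\<And>s t. t0 \<le> s \<Longrightarrow> s \<le> t \<Longrightarrow> f t \<le> f s"
    and bound: "\<And>t. t0 \<le> t \<Longrightarrow> m \<le> f t"
  obtains L where "(f \<longlongrightarrow> L) at_top" "m \<le> L"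
proof
  let ?L = "Inf (f ` {t0..})"
  have bdd: "bdd_below (f ` {t0..})" using bound by (intro bdd_belowI2) auto
  show "(f \<longlongrightarrow> ?L) at_top"
  proof (rule order_tendstoI)
    fix a
    assume "a < ?L"
    then have "a < f t" if "t \<ge> t0" for t
      using cINF_lower[OF bdd, of t] that by simp
    then show "\<forall>\<^sub>F t in at_top. a < f t" by (rule eventually_at_top_linorderI)
  next
    fix a
    assume "?L < a"
    then obtain s where "s \<ge> t0" "f s < a" using cInf_lessD[of "f ` {t0..}" a] by auto
    then show "\<forall>\<^sub>F t in at_top. f t < a"
      using antimono by (intro eventually_at_top_linorderI[of s]) (meson le_less_trans)
  qed
  show "m \<le> ?L" using bound by (intro cINF_greatest) auto
qed

lemma integral_split_from:
  fixes f :: "real \<Rightarrow> real"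
  assumes int: "\<And>T. T \<ge> t0 \<Longrightarrow> f integrable_on {t0..T}" and ab: "t0 \<le> a" "a \<le> b"
  shows "f integrable_on {a..b}" "integral {a..b} f = integral {t0..b} f - integral {t0..a} f"
proof -
  have b: "f integrable_on {t0..b}" by (rule int) (use ab in linarith)
  then show "f integrable_on {a..b}"
    by (rule integrable_on_subinterval) (use ab in auto)
  show "integral {a..b} f = integral {t0..b} f - integral {t0..a} f"
    using Henstock_Kurzweil_Integration.integral_combine[OF ab b] by simp
qed

lemma bounded_integral_imp_tendsto:
  fixes f :: "real \<Rightarrow> real"
  assumes int: "\<And>T. T \<ge> t0 \<Longrightarrow> f integrable_on {t0..T}" and nonneg: "\<And>t. t \<ge> t0 \<Longrightarrow> f t \<ge> 0"
    and bound: "\<And>T. T \<ge> t0 \<Longrightarrow> integral {t0..T} f \<le> B"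
  obtains L where "((\<lambda>T. integral {t0..T} f) \<longlongrightarrow> L) at_top"
proof -
  have mono: "- integral {t0..t} f \<le> - integral {t0..s} f" if st: "t0 \<le> s" "s \<le> t" for s t
  proof -
    have "0 \<le> integral {s..t} f"
      by (rule integral_nonneg[OF integral_split_from(1)[OF int st]]) (use nonneg st in auto)
    then show ?thesis using integral_split_from(2)[OF int st] by simp
  qed
  obtain L where "((\<lambda>T. - integral {t0..T} f) \<longlongrightarrow> L) at_top"
    by (rule antimono_bounded_below_tendsto[OF mono, where m = "- B"])
      (auto intro!: neg_le_iff_le[THEN iffD2] bound)
  then have "((\<lambda>T. - (- integral {t0..T} f)) \<longlongrightarrow> - L) at_top" by (rule tendsto_minus)
  then show ?thesis by (intro that[of "- L"]) simp
qed

text \<open>Otherwise \<open>f\<close> eventually stays above \<open>c\<close> and its integral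
  grows at least linearly.\<close>

lemma bounded_integral_imp_frequently_small:
  fixes f :: "real \<Rightarrow> real"
  assumes int: "\<And>T. T \<ge> t0 \<Longrightarrow> f integrable_on {t0..T}"
    and bound: "\<And>T. T \<ge> t0 \<Longrightarrow> integral {t0..T} f \<le> B" and "c > 0"
  shows "\<exists>\<^sub>F t in at_top. f t < c"
proof (rule ccontr)
  assume "\<not> ?thesis"
  then obtain a where a: "\<And>t. t \<ge> a \<Longrightarrow> c \<le> f t"
    by (auto simp: frequently_def eventually_at_top_linorder not_less)
  define s where "s = max a t0"
  \<comment> \<open>Long enough that \<open>c * (T - s)\<close> exceeds
    \<open>B - integral {t0..s} f\<close> by at least 1.\<close>
  define T where "T = s + (\<bar>B\<bar> + \<bar>integral {t0..s} f\<bar> + 1) / c"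
  have sT: "t0 \<le> s" "s \<le> T" using \<open>c > 0\<close> by (auto simp: s_def T_def)
  have "c * (T - s) = integral {s..T} (\<lambda>_. c)" using sT by simp
  also have "\<dots> \<le> integral {s..T} f"
    using integral_split_from(1)[OF int sT] a by (intro integral_le) (auto simp: s_def)
  also have "\<dots> = integral {t0..T} f - integral {t0..s} f"
    using integral_split_from(2)[OF int sT] by simp
  also have "\<dots> \<le> B - integral {t0..s} f" using bound[of T] sT by simp
  finally have "c * (T - s) \<le> B - integral {t0..s} f" .
  moreover have "c * (T - s) = \<bar>B\<bar> + \<bar>integral {t0..s} f\<bar> + 1"
    using \<open>c > 0\<close> by (simp add: T_def)
  ultimately show False by linarith
qed

lemma continuous_on_imp_integrable_from:
  fixes f :: "real \<Rightarrow> real"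
  assumes "continuous_on {t0..} f"
  shows "f integrable_on {t0..T}"
  using assms by (intro integrable_continuous_real) (auto intro: continuous_on_subset)

lemma integral_derivative_from:
  fixes f :: "real \<Rightarrow> real"
  assumes "\<And>t. t \<ge> t0 \<Longrightarrow> (f has_real_derivative f' t) (at t within {t0..})" "t0 \<le> a" "a \<le> b"
  shows "(f' has_integral (f b - f a)) {a..b}"
proof (rule fundamental_theorem_of_calculus[OF \<open>a \<le> b\<close>])
  fix t
  assume "t \<in> {a..b}"
  then have "(f has_vector_derivative f' t) (at t within {t0..})"
    using assms by (auto simp: has_real_derivative_iff_has_vector_derivative)
  then show "(f has_vector_derivative f' t) (at t within {a..b})"
    by (rule has_vector_derivative_within_subset) (use assms in auto)
qed

text \<open>Turns finiteness of a Lebesgue integral over the half-line into a uniform bound for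
  gauge integrals over \<open>{t0..T}\<close>, the form used in the energy estimates.\<close>

lemma nn_integral_finite_imp_integral_le:
  fixes e :: "real \<Rightarrow> real"
  assumes meas: "e \<in> borel_measurable (lebesgue_on {t0..T})" and nonneg: "\<And>t. t \<ge> t0 \<Longrightarrow> e t \<ge> 0"
    and fin: "(\<integral>\<^sup>+ t\<in>{t0..}. ennreal (e t) \<partial>lebesgue) < \<infinity>"
  shows "e integrable_on {t0..T}"
    "integral {t0..T} e \<le> enn2real (\<integral>\<^sup>+ t\<in>{t0..}. ennreal (e t) \<partial>lebesgue)"
proof -
  let ?I = "\<integral>\<^sup>+ t\<in>{t0..}. ennreal (e t) \<partial>lebesgue"
  have m: "(\<lambda>t. indicator {t0..T} t *\<^sub>R e t) \<in> borel_measurable lebesgue"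
    using meas by (subst (asm) borel_measurable_restrict_space_iff) auto
  have le: "(\<integral>\<^sup>+ t. ennreal (indicator {t0..T} t *\<^sub>R e t) \<partial>lebesgue) \<le> ?I"
    by (intro nn_integral_mono) (auto split: split_indicator)
  have int: "integrable lebesgue (\<lambda>t. indicator {t0..T} t *\<^sub>R e t)"
    using m le fin nonneg
    by (intro integrableI_nonneg) (auto split: split_indicator intro: le_less_trans)
  then have ai: "e absolutely_integrable_on {t0..T}" by (simp add: set_integrable_def)
  then show "e integrable_on {t0..T}" by (rule set_lebesgue_integral_eq_integral(1))
  have "ennreal (integral\<^sup>L lebesgue (\<lambda>t. indicator {t0..T} t *\<^sub>R e t)) \<le> ?I"
    using le nn_integral_eq_integral[OF int] nonneg by (auto split: split_indicator)
  moreover have "integral {t0..T} e = integral\<^sup>L lebesgue (\<lambda>t. indicator {t0..T} t *\<^sub>R e t)"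
    using set_lebesgue_integral_eq_integral(2)[OF ai] by (simp add: set_lebesgue_integral_def)
  ultimately have "ennreal (integral {t0..T} e) \<le> ?I" by simp
  moreover have "?I = ennreal (enn2real ?I)" using fin by (simp add: ennreal_enn2real_if less_top)
  ultimately have "ennreal (integral {t0..T} e) \<le> ennreal (enn2real ?I)" by metis
  then show "integral {t0..T} e \<le> enn2real ?I" by (simp add: ennreal_le_iff)
qed

text \<open>The passage back, by monotone convergence along \<open>{t0..t0 + real n}\<close>. It
  yields the final square integrability of \<open>xdd\<close> and, by contradiction, exploits the
  divergence of the integral of \<open>\<delta> t * \<alpha>0 t\<close>.\<close>

lemma bounded_integral_imp_nn_integral_finite:
  fixes f :: "real \<Rightarrow> real"
  assumes int: "\<And>T. T \<ge> t0 \<Longrightarrow> f integrable_on {t0..T}" and nonneg: "\<And>t. t \<ge> t0 \<Longrightarrow> f t \<ge> 0"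
    and bound: "\<And>T. T \<ge> t0 \<Longrightarrow> integral {t0..T} f \<le> B"
  shows "(\<integral>\<^sup>+ t\<in>{t0..}. ennreal (f t) \<partial>lebesgue) < \<infinity>"
proof -
  define F where "F n t = ennreal (indicator {t0..t0 + real n} t * f t)" for n t
  have meas: "F n \<in> borel_measurable lebesgue" for n
  proof -
    have "(f has_integral integral {t0..t0 + real n} f) {t0..t0 + real n}"
      by (intro integrable_integral int) simp
    then have "(\<lambda>t. indicator {t0..t0 + real n} t *\<^sub>R f t) \<in> borel_measurable lebesgue"
      by (rule has_integral_implies_lebesgue_measurable)
    then show ?thesis unfolding F_def by simp
  qed
  have inc: "incseq F"
    by (auto simp: F_def incseq_def le_fun_def nonneg split: split_indicator)
  have "(\<integral>\<^sup>+ t\<in>{t0..}. ennreal (f t) \<partial>lebesgue) \<le> (\<integral>\<^sup>+ t. (SUP n. F n t) \<partial>lebesgue)"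
  proof (rule nn_integral_mono)
    fix t
    obtain n where n: "t - t0 \<le> real n" using real_arch_simple by blast
    have "ennreal (f t) * indicator {t0..} t \<le> F n t"
      using n by (auto simp: F_def split: split_indicator)
    also have "\<dots> \<le> (SUP n. F n t)" by (rule SUP_upper) simp
    finally show "ennreal (f t) * indicator {t0..} t \<le> (SUP n. F n t)" .
  qed
  also have "\<dots> = (SUP n. \<integral>\<^sup>+ t. F n t \<partial>lebesgue)"
    by (rule nn_integral_monotone_convergence_SUP[OF inc meas])
  also have "\<dots> \<le> ennreal B"
  proof (rule SUP_least)
    fix n
    have "(\<integral>\<^sup>+ t. F n t \<partial>lebesgue) = integral {t0..t0 + real n} f"
      unfolding F_def nn_integral_completion
      by (rule nn_integral_has_integral_lebesgue) (auto intro!: nonneg integrable_integral int)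
    also have "\<dots> \<le> ennreal B" by (intro ennreal_leI bound) simp
    finally show "(\<integral>\<^sup>+ t. F n t \<partial>lebesgue) \<le> ennreal B" .
  qed
  finally show ?thesis using le_less_trans by fastforce
qed

subsection \<open>Second-order inequalities with nonincreasing damping\<close>

text \<open>Interface for \<open>w = \<alpha>1 - \<delta> lam\<close>, instantiated with
  \<open>\<kappa> = C1 / 2\<close>. Monotonicity is stated directly, not through a derivative, which
  suits the second mean value theorem for integrals.\<close>

locale damping =
  fixes t0 \<kappa> :: real and w :: "real \<Rightarrow> real"
  assumes w_antimono: "\<And>s t. t0 \<le> s \<Longrightarrow> s \<le> t \<Longrightarrow> w t \<le> w s"
    and w_lower: "\<And>t. t0 \<le> t \<Longrightarrow> \<kappa> \<le> w t"
    and \<kappa>_pos: "0 < \<kappa>"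
    and w_cont: "continuous_on {t0..} w"
begin

text \<open>Integration by parts, with the nonpositive term \<open>\<integral> h dw\<close> discarded.\<close>

lemma weighted_integral_derivative_ge:
  assumes h: "\<And>t. t \<ge> t0 \<Longrightarrow> (h has_real_derivative h1 t) (at t within {t0..})"
    and nonneg: "\<And>t. t \<ge> t0 \<Longrightarrow> h t \<ge> 0" and ab: "t0 \<le> a" "a \<le> b"
  shows "w b * h b - w a * h a \<le> integral {a..b} (\<lambda>t. w t * h1 t)"
proof -
  have "h1 integrable_on {a..b}" using integral_derivative_from[OF h ab] by blast
  \<comment> \<open>The second mean value theorem, applied to the nondecreasing function
    \<open>- w\<close>, takes the place of a Stieltjes integral against \<open>w\<close>.\<close>
  then obtain c where c: "c \<in> {a..b}"
    "integral {a..b} (\<lambda>t. - w t * h1 t) = - w a * integral {a..c} h1 + - w b * integral {c..b} h1"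
    by (rule second_mean_value_theorem[OF _ \<open>a \<le> b\<close>, of h1 "\<lambda>t. - w t"])
      (use ab in \<open>auto intro: w_antimono\<close>)
  have ac: "integral {a..c} h1 = h c - h a" and cb: "integral {c..b} h1 = h b - h c"
    using c(1) ab by (auto intro!: integral_unique integral_derivative_from h)
  have "integral {a..b} (\<lambda>t. w t * h1 t) = w b * h b - w a * h a + (w a - w b) * h c"
    using c(2) unfolding ac cb by (simp add: algebra_simps)
  moreover have "(w a - w b) * h c \<ge> 0"
    using w_antimono[OF ab] nonneg c(1) ab by (intro mult_nonneg_nonneg) auto
  ultimately show ?thesis by simp
qed

text \<open>The estimates come from integrating
  \<open>\<parallel>v' + w v\<parallel>\<^sup>2 = \<parallel>v'\<parallel>\<^sup>2 + w (\<parallel>v\<parallel>\<^sup>2)' + w\<^sup>2 \<parallel>v\<parallel>\<^sup>2\<close>.\<close>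

lemma damped_velocity:
  fixes v vd :: "real \<Rightarrow> 'a::real_inner"
  assumes v: "\<And>t. t \<ge> t0 \<Longrightarrow> (v has_vector_derivative vd t) (at t within {t0..})"
    and vd_cont: "continuous_on {t0..} vd"
    and force: "\<And>T. T \<ge> t0 \<Longrightarrow> integral {t0..T} (\<lambda>t. (norm (vd t + w t *\<^sub>R v t))\<^sup>2) \<le> M"
  obtains B where "\<And>T. T \<ge> t0 \<Longrightarrow> integral {t0..T} (\<lambda>t. (norm (vd t))\<^sup>2) \<le> B"
    "\<And>T. T \<ge> t0 \<Longrightarrow> integral {t0..T} (\<lambda>t. (norm (v t))\<^sup>2) \<le> B"
    "\<And>t. t \<ge> t0 \<Longrightarrow> norm (v t) \<le> B"
    "(v \<longlongrightarrow> 0) at_top"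
proof -
  define q where "q t = (norm (v t))\<^sup>2" for t
  define qd where "qd t = 2 * (v t \<bullet> vd t)" for t
  define a where "a t = (norm (vd t))\<^sup>2" for t
  have v_cont: "continuous_on {t0..} v"
    using v by (auto simp: continuous_on_eq_continuous_within intro: has_vector_derivative_continuous)
  have cont: "continuous_on {t0..} q" "continuous_on {t0..} qd" "continuous_on {t0..} a"
    unfolding q_def qd_def a_def by (intro continuous_intros v_cont vd_cont)+
  have q: "(q has_real_derivative qd t) (at t within {t0..})" if "t \<ge> t0" for t
  proof -
    have "((\<lambda>t. v t \<bullet> v t) has_derivative (\<lambda>s. v t \<bullet> (s *\<^sub>R vd t) + (s *\<^sub>R vd t) \<bullet> v t)) (at t within {t0..})"
      using v[OF that] unfolding has_vector_derivative_def by (intro has_derivative_inner)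
    then show ?thesis
      unfolding has_field_derivative_def q_def qd_def power2_norm_eq_inner
      by (rule has_derivative_eq_rhs) (auto simp: inner_commute)
  qed
  have q0: "q t \<ge> 0" and a0: "a t \<ge> 0" for t by (auto simp: q_def a_def)
  define M' where "M' = M + w t0 * q t0"
  \<comment> \<open>All three terms on the left are nonnegative, so each is bounded by
    \<open>M'\<close> on its own; this gives the three bounds of the conclusion.\<close>
  have energy: "integral {t0..T} a + \<kappa>\<^sup>2 * integral {t0..T} q + w T * q T \<le> M'" if "T \<ge> t0" for T
  proof -
    have eq: "(norm (vd t + w t *\<^sub>R v t))\<^sup>2 = a t + w t * qd t + (w t)\<^sup>2 * q t" for t
      unfolding a_def qd_def q_def power2_norm_eq_inner
      by (simp add: inner_add_left inner_add_right inner_commute power2_eq_square algebra_simps)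
    have int: "a integrable_on {t0..T}" "(\<lambda>t. w t * qd t) integrable_on {t0..T}"
      "(\<lambda>t. (w t)\<^sup>2 * q t) integrable_on {t0..T}" "(\<lambda>t. \<kappa>\<^sup>2 * q t) integrable_on {t0..T}"
      by (intro continuous_on_imp_integrable_from continuous_intros cont w_cont)+
    have "integral {t0..T} (\<lambda>t. (norm (vd t + w t *\<^sub>R v t))\<^sup>2)
        = integral {t0..T} a + integral {t0..T} (\<lambda>t. w t * qd t) + integral {t0..T} (\<lambda>t. (w t)\<^sup>2 * q t)"
      unfolding eq using int
      by (simp add: Henstock_Kurzweil_Integration.integral_add integrable_add)
    moreover have "\<kappa>\<^sup>2 * integral {t0..T} q \<le> integral {t0..T} (\<lambda>t. (w t)\<^sup>2 * q t)"
    proof -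
      have "\<kappa>\<^sup>2 * integral {t0..T} q = integral {t0..T} (\<lambda>t. \<kappa>\<^sup>2 * q t)" by simp
      also have "\<dots> \<le> integral {t0..T} (\<lambda>t. (w t)\<^sup>2 * q t)"
        using int w_lower \<kappa>_pos q0 by (intro integral_le mult_right_mono power_mono) auto
      finally show ?thesis .
    qed
    moreover have "w T * q T - w t0 * q t0 \<le> integral {t0..T} (\<lambda>t. w t * qd t)"
      using weighted_integral_derivative_ge[OF q q0 order_refl that] by simp
    ultimately show ?thesis using force[OF that] by (simp add: M'_def)
  qed
  have int: "q integrable_on {t0..T}" "a integrable_on {t0..T}" "qd integrable_on {t0..T}" for T
    by (intro continuous_on_imp_integrable_from cont)+
  have Iq: "integral {t0..T} q \<ge> 0" and Ia: "integral {t0..T} a \<ge> 0" for T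
    using int q0 a0 by (auto intro!: integral_nonneg)
  have wq: "w t * q t \<ge> \<kappa> * q t" and kq: "\<kappa> * q t \<ge> 0" if "t \<ge> t0" for t
    using w_lower[OF that] q0 \<kappa>_pos by (auto intro!: mult_right_mono)
  have k2: "\<kappa>\<^sup>2 * integral {t0..T} q \<ge> 0" for T using Iq by simp
  have "M' \<ge> 0" using energy[of t0] Ia[of t0] k2[of t0] wq[of t0] kq[of t0] by linarith
  define B where "B = 1 + M' + M' / \<kappa>\<^sup>2 + M' / \<kappa>"
  have B_ge: "M' \<le> B" "M' / \<kappa>\<^sup>2 \<le> B" "1 + M' / \<kappa> \<le> B" using \<open>M' \<ge> 0\<close> \<kappa>_pos by (auto simp: B_def)
  have aB: "integral {t0..T} a \<le> B" if "T \<ge> t0" for T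
    using energy[OF that] k2[of T] wq[OF that] kq[OF that] B_ge by linarith
  have qB: "integral {t0..T} q \<le> B" if "T \<ge> t0" for T
  proof -
    have "\<kappa>\<^sup>2 * integral {t0..T} q \<le> M'"
      using energy[OF that] Ia[of T] wq[OF that] kq[OF that] by linarith
    then have "integral {t0..T} q \<le> M' / \<kappa>\<^sup>2" using \<kappa>_pos by (simp add: field_simps)
    then show ?thesis using B_ge by linarith
  qed
  have vB: "norm (v t) \<le> B" if "t \<ge> t0" for t
  proof -
    have "\<kappa> * q t \<le> M'" using energy[OF that] Ia[of t] k2[of t] wq[OF that] by linarith
    then have "q t \<le> M' / \<kappa>" using \<kappa>_pos by (simp add: field_simps)
    \<comment> \<open>From \<open>(norm (v t) - 1)\<^sup>2 \<ge> 0\<close>; this is the source of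
      the summand 1 in \<open>B\<close>.\<close>
    moreover have "norm (v t) \<le> 1 + q t"
      using zero_le_power2[of "norm (v t) - 1"] norm_ge_zero[of "v t"]
      unfolding q_def power2_diff by (simp del: norm_ge_zero)
    ultimately show ?thesis using B_ge by linarith
  qed
  have int_qa: "(\<lambda>t. q t + a t) integrable_on {t0..T}" for T using int by (intro integrable_add)
  have I: "integral {t0..T} (\<lambda>t. q t + a t) = integral {t0..T} q + integral {t0..T} a" for T
    using int by (intro Henstock_Kurzweil_Integration.integral_add)
  obtain L1 where L1: "((\<lambda>T. integral {t0..T} (\<lambda>t. q t + a t)) \<longlongrightarrow> L1) at_top"
  proof (rule bounded_integral_imp_tendsto[of t0 "\<lambda>t. q t + a t" "2 * B"])
    show "integral {t0..T} (\<lambda>t. q t + a t) \<le> 2 * B" if "T \<ge> t0" for T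
      using aB[OF that] qB[OF that] I[of T] by simp
  qed (use int_qa q0 a0 in auto)
  \<comment> \<open>Since \<open>qd \<le> q + a\<close>, subtracting the integral of
    \<open>q + a\<close> leaves a nonincreasing function. It is bounded below and so converges, and
    with it \<open>q\<close>.\<close>
  obtain L2 where L2: "((\<lambda>T. q T - integral {t0..T} (\<lambda>t. q t + a t)) \<longlongrightarrow> L2) at_top"
  proof (rule antimono_bounded_below_tendsto[of t0 "\<lambda>T. q T - integral {t0..T} (\<lambda>t. q t + a t)" "- (2 * B)"])
    fix s t
    assume st: "t0 \<le> s" "s \<le> t"
    have "q t - q s = integral {s..t} qd"
      using integral_derivative_from[OF q st] by (simp add: integral_unique)
    also have "\<dots> \<le> integral {s..t} (\<lambda>t. q t + a t)"
    proof (rule integral_le)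
      fix r
      have "2 * (v r \<bullet> vd r) \<le> 2 * (norm (v r) * norm (vd r))"
        using norm_cauchy_schwarz by simp
      also have "\<dots> \<le> (norm (v r))\<^sup>2 + (norm (vd r))\<^sup>2"
        using sum_squares_bound[of "norm (v r)" "norm (vd r)"] by simp
      finally show "qd r \<le> q r + a r" by (simp add: qd_def q_def a_def)
    qed (use integral_split_from(1)[OF int(3) st] integral_split_from(1)[OF int_qa st] in auto)
    also have "\<dots> = integral {t0..t} (\<lambda>t. q t + a t) - integral {t0..s} (\<lambda>t. q t + a t)"
      by (rule integral_split_from(2)[OF int_qa st])
    finally show "q t - integral {t0..t} (\<lambda>t. q t + a t) \<le> q s - integral {t0..s} (\<lambda>t. q t + a t)"
      by simp
  next
    show "- (2 * B) \<le> q t - integral {t0..t} (\<lambda>t. q t + a t)" if "t0 \<le> t" for t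
      using aB[OF that] qB[OF that] I[of t] q0[of t] by simp
  qed
  have lim: "(q \<longlongrightarrow> L1 + L2) at_top" using tendsto_add[OF L1 L2] by simp
  \<comment> \<open>A positive limit would keep \<open>q\<close> away from 0, against the
    boundedness of its integrals.\<close>
  have "\<not> L1 + L2 > 0"
  proof
    assume pos: "L1 + L2 > 0"
    then have "\<forall>\<^sub>F t in at_top. (L1 + L2) / 2 < q t" using lim by (intro order_tendstoD(1)) auto
    moreover have "\<exists>\<^sub>F t in at_top. q t < (L1 + L2) / 2"
      by (rule bounded_integral_imp_frequently_small[of t0 q B]) (use int qB pos in auto)
    moreover from calculation have "\<forall>\<^sub>F t in at_top. \<not> q t < (L1 + L2) / 2"
      by (auto elim: eventually_mono)
    ultimately show False by (simp add: frequently_def)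
  qed
  moreover have "L1 + L2 \<ge> 0" by (rule tendsto_lowerbound[OF lim]) (use q0 in auto)
  ultimately have "(q \<longlongrightarrow> 0) at_top" using lim by (simp add: not_less order_antisym)
  then have "((\<lambda>t. sqrt (q t)) \<longlongrightarrow> 0) at_top" using tendsto_real_sqrt by fastforce
  then have "(v \<longlongrightarrow> 0) at_top" unfolding q_def by (simp add: tendsto_norm_zero_iff)
  then show ?thesis using that aB qB vB unfolding a_def q_def by blast
qed

text \<open>Integrate the differential inequality over \<open>{a..b}\<close> and bound the damping
  term by \<open>weighted_integral_derivative_ge\<close>. With the integral of \<open>p\<close> kept
  on the left, one estimate serves to bound both \<open>h\<close> and that integral.\<close>

lemma dissipation:
  assumes h: "\<And>t. t \<ge> t0 \<Longrightarrow> (h has_real_derivative h1 t) (at t within {t0..})"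
    and h1: "\<And>t. t \<ge> t0 \<Longrightarrow> (h1 has_real_derivative h2 t) (at t within {t0..})"
    and h2: "continuous_on {t0..} h2" and nonneg: "\<And>t. t \<ge> t0 \<Longrightarrow> h t \<ge> 0"
    and g: "\<And>T. T \<ge> t0 \<Longrightarrow> g integrable_on {t0..T}"
    and p: "\<And>T. T \<ge> t0 \<Longrightarrow> p integrable_on {t0..T}"
    and le: "AE t in lebesgue. t \<ge> t0 \<longrightarrow> h2 t + w t * h1 t \<le> g t - p t"
    and ab: "t0 \<le> a" "a \<le> b"
  shows "h1 b + w b * h b + integral {a..b} p \<le> h1 a + w a * h a + integral {a..b} g"
proof -
  have h1_cont: "continuous_on {t0..} h1"
    using h1 by (auto simp: continuous_on_eq_continuous_within intro: DERIV_continuous)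
  have i2: "h2 integrable_on {a..b}" and i1: "(\<lambda>t. w t * h1 t) integrable_on {a..b}"
    by (rule integral_split_from(1)[OF _ ab];
        intro continuous_on_imp_integrable_from continuous_intros h2 w_cont h1_cont)+
  have ig: "g integrable_on {a..b}" and ip: "p integrable_on {a..b}"
    by (rule integral_split_from(1)[OF g ab], assumption) (rule integral_split_from(1)[OF p ab], assumption)
  have "integral {a..b} (\<lambda>t. h2 t + w t * h1 t) \<le> integral {a..b} (\<lambda>t. g t - p t)"
    by (rule integral_mono_AE[OF integrable_add[OF i2 i1] integrable_diff[OF ig ip]])
      (rule eventually_mono[OF le], use ab in auto)
  moreover have "integral {a..b} (\<lambda>t. h2 t + w t * h1 t) = integral {a..b} h2 + integral {a..b} (\<lambda>t. w t * h1 t)"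
    by (rule Henstock_Kurzweil_Integration.integral_add[OF i2 i1])
  moreover have "integral {a..b} (\<lambda>t. g t - p t) = integral {a..b} g - integral {a..b} p"
    by (rule Henstock_Kurzweil_Integration.integral_diff[OF ig ip])
  moreover have "integral {a..b} h2 = h1 b - h1 a"
    by (rule integral_unique, rule integral_derivative_from[OF h1 ab])
  moreover have "w b * h b - w a * h a \<le> integral {a..b} (\<lambda>t. w t * h1 t)"
    by (rule weighted_integral_derivative_ge[OF h nonneg ab])
  ultimately show ?thesis by linarith
qed

text \<open>A Gronwall argument: \<open>h \<ge> 0\<close> and \<open>w \<ge> \<kappa>\<close> give
  \<open>h1 + \<kappa> * h \<le> K\<close>, so \<open>h - K / \<kappa>\<close> times the integrating
  factor \<open>exp (\<kappa> * (s - t0))\<close> is nonincreasing.\<close>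

lemma damped_bounded:
  assumes h: "\<And>t. t \<ge> t0 \<Longrightarrow> (h has_real_derivative h1 t) (at t within {t0..})"
    and nonneg: "\<And>t. t \<ge> t0 \<Longrightarrow> h t \<ge> 0"
    and le: "\<And>t. t \<ge> t0 \<Longrightarrow> h1 t + w t * h t \<le> K"
    and t: "t \<ge> t0"
  shows "h t \<le> h t0 + 2 * \<bar>K\<bar> / \<kappa>"
proof -
  define k where "k s = (h s - K / \<kappa>) * exp (\<kappa> * (s - t0))" for s
  define k1 where "k1 s = (h1 s + \<kappa> * h s - K) * exp (\<kappa> * (s - t0))" for s
  have "(k has_real_derivative k1 s) (at s within {t0..})" if "s \<ge> t0" for s
    unfolding k_def k1_def using \<kappa>_pos
    by (auto intro!: derivative_eq_intros h[OF that] simp: field_simps)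
  then have "(k1 has_integral (k t - k t0)) {t0..t}"
    by (rule integral_derivative_from[OF _ order_refl t])
  moreover have "k1 s \<le> 0" if "s \<in> {t0..t}" for s
  proof -
    have "\<kappa> * h s \<le> w s * h s" using that by (intro mult_right_mono w_lower nonneg) auto
    then show ?thesis using le[of s] that by (auto simp: k1_def mult_nonpos_nonneg)
  qed
  ultimately have "k t - k t0 \<le> 0" by (rule has_integral_le[OF _ has_integral_0])
  then have k: "(h t - K / \<kappa>) * exp (\<kappa> * (t - t0)) \<le> h t0 - K / \<kappa>" by (simp add: k_def)
  have ex: "1 \<le> exp (\<kappa> * (t - t0))" using \<kappa>_pos t by simp
  have "h t - K / \<kappa> \<le> h t0 + \<bar>K\<bar> / \<kappa>"
  proof (cases "h t - K / \<kappa> \<ge> 0")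
    case True
    have "h t - K / \<kappa> \<le> (h t - K / \<kappa>) * exp (\<kappa> * (t - t0))"
      using mult_left_mono[OF ex True] by simp
    moreover have "- K / \<kappa> \<le> \<bar>K\<bar> / \<kappa>" using \<kappa>_pos by (intro divide_right_mono) auto
    ultimately show ?thesis using k by simp
  next
    case False
    then show ?thesis using nonneg[of t0] \<kappa>_pos
      by (smt (verit) divide_nonneg_pos)
  qed
  moreover have "K / \<kappa> \<le> \<bar>K\<bar> / \<kappa>" using \<kappa>_pos by (intro divide_right_mono) auto
  ultimately show ?thesis by simp
qed

text \<open>The function \<open>h1 + w * h\<close> minus the accumulated integral of
  \<open>g\<close> is nonincreasing and bounded below, hence converges. As \<open>h1\<close> tends
  to 0 and \<open>w\<close> has a positive limit, solving for \<open>h\<close> gives its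
  limit.\<close>

lemma damped_tendsto:
  assumes nonneg: "\<And>t. t \<ge> t0 \<Longrightarrow> h t \<ge> 0"
    and h1_lim: "(h1 \<longlongrightarrow> 0) at_top" and h1_lower: "\<And>t. t \<ge> t0 \<Longrightarrow> - B \<le> h1 t"
    and g: "\<And>T. T \<ge> t0 \<Longrightarrow> g integrable_on {t0..T}" "\<And>t. t \<ge> t0 \<Longrightarrow> 0 \<le> g t"
      "\<And>T. T \<ge> t0 \<Longrightarrow> integral {t0..T} g \<le> M"
    and le: "\<And>a b. t0 \<le> a \<Longrightarrow> a \<le> b \<Longrightarrow> h1 b + w b * h b \<le> h1 a + w a * h a + integral {a..b} g"
  obtains L where "(h \<longlongrightarrow> L) at_top"
proof -
  obtain L1 where L1: "((\<lambda>T. integral {t0..T} g) \<longlongrightarrow> L1) at_top"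
    using bounded_integral_imp_tendsto[OF g] by blast
  obtain L2 where L2: "((\<lambda>T. h1 T + w T * h T - integral {t0..T} g) \<longlongrightarrow> L2) at_top"
  proof (rule antimono_bounded_below_tendsto[of t0 "\<lambda>T. h1 T + w T * h T - integral {t0..T} g" "- B - M"])
    fix s t
    assume st: "t0 \<le> s" "s \<le> t"
    show "h1 t + w t * h t - integral {t0..t} g \<le> h1 s + w s * h s - integral {t0..s} g"
      using le[OF st] integral_split_from(2)[OF g(1) st] by simp
  next
    fix t
    assume t: "t0 \<le> t"
    have "0 \<le> w t * h t" using w_lower[OF t] \<kappa>_pos nonneg[OF t] by simp
    then show "- B - M \<le> h1 t + w t * h t - integral {t0..t} g"
      using h1_lower[OF t] g(3)[OF t] by simp
  qed
  obtain W where W: "(w \<longlongrightarrow> W) at_top" "\<kappa> \<le> W"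
    using antimono_bounded_below_tendsto[of t0 w \<kappa>] w_antimono w_lower by blast
  have "((\<lambda>t. ((h1 t + w t * h t - integral {t0..t} g) + integral {t0..t} g - h1 t) / w t)
      \<longlongrightarrow> (L2 + L1 - 0) / W) at_top"
    using W \<kappa>_pos by (intro tendsto_intros L1 L2 h1_lim) auto
  moreover have "\<forall>\<^sub>F t in at_top.
      ((h1 t + w t * h t - integral {t0..t} g) + integral {t0..t} g - h1 t) / w t = h t"
    using w_lower \<kappa>_pos by (intro eventually_at_top_linorderI[of t0]) force
  ultimately have "(h \<longlongrightarrow> (L2 + L1 - 0) / W) at_top" by (rule Lim_transform_eventually)
  then show ?thesis by (rule that)
qed

end

subsection \<open>Projections and paramonotone operators\<close>

text \<open>Both bounds come from the variational inequality of the projection, tested at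
  \<open>z\<close> and at \<open>s\<close>. The normalization by \<open>max 1 (norm (U z))\<close>
  keeps the step before projection no longer than \<open>a\<close>.\<close>

lemma projected_step_bounds:
  fixes \<Omega> :: "'a::euclidean_space set" and U :: "'a \<Rightarrow> 'a"
  assumes \<Omega>: "closed \<Omega>" "convex \<Omega>" and z: "z \<in> \<Omega>" and s: "s \<in> \<Omega>" and a: "a \<ge> 0"
  defines "y \<equiv> projected_step U \<Omega> a z"
  shows "norm (y - z) \<le> a"
    and "(y - z) \<bullet> (z - s) \<le> a\<^sup>2 - a * (U z \<bullet> (z - s) / max 1 (norm (U z)))"
proof -
  define u where "u = (a / max 1 (norm (U z))) *\<^sub>R U z"
  define d where "d = y - z"
  have "norm u = a * (norm (U z) / max 1 (norm (U z)))" using a by (simp add: u_def)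
  also have "\<dots> \<le> a * 1" using a by (intro mult_left_mono) (auto simp: divide_le_eq max_def)
  finally have u: "norm u \<le> a" by simp
  have y: "y = closest_point \<Omega> (z - u)" by (simp add: y_def projected_step_def u_def)
  have "(z - u - y) \<bullet> (z - y) \<le> 0" "(z - u - y) \<bullet> (s - y) \<le> 0"
    unfolding y by (intro closest_point_dot \<Omega> z s)+
  then have 1: "(norm d)\<^sup>2 + u \<bullet> d \<le> 0" and 2: "d \<bullet> (z - s) + (norm d)\<^sup>2 + u \<bullet> (z - s) + u \<bullet> d \<le> 0"
    unfolding d_def power2_norm_eq_inner by (simp_all add: inner_diff_left inner_diff_right inner_commute)
  have ud: "- (u \<bullet> d) \<le> a * norm d"
    using norm_cauchy_schwarz[of "- u" d] mult_right_mono[OF u, of "norm d"] by simp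
  then have "norm d * norm d \<le> a * norm d" using 1 by (simp add: power2_eq_square)
  then have d: "norm d \<le> a" using a by (cases "norm d = 0") (auto simp: mult_le_cancel_right)
  then show "norm (y - z) \<le> a" by (simp add: d_def)
  have "a * norm d \<le> a\<^sup>2" using mult_left_mono[OF d a] by (simp add: power2_eq_square)
  then have "d \<bullet> (z - s) \<le> a\<^sup>2 - u \<bullet> (z - s)" using 2 ud zero_le_power2[of "norm d"] by linarith
  then show "(y - z) \<bullet> (z - s) \<le> a\<^sup>2 - a * (U z \<bullet> (z - s) / max 1 (norm (U z)))"
    by (simp add: d_def u_def)
qed

text \<open>Minty's inequality: monotonicity between \<open>z\<close> and \<open>s\<close> added to
  the inequality that defines \<open>s\<close>.\<close>

lemma Sol_monotone_nonneg:
  assumes "monotone_operator_on \<Omega> U" "s \<in> Sol U \<Omega>" "z \<in> \<Omega>"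
  shows "0 \<le> U z \<bullet> (z - s)"
proof -
  have "0 \<le> (U z - U s) \<bullet> (z - s)" "0 \<le> U s \<bullet> (z - s)"
    using assms by (auto simp: monotone_operator_on_def Sol_def)
  then show ?thesis by (simp add: inner_diff_left)
qed

text \<open>Two nonnegative terms with sum at most 0 both vanish. Paramonotonicity then gives
  \<open>U z = U s\<close>, and \<open>U s \<bullet> (z - s) = 0\<close> lets \<open>z\<close>
  replace \<open>s\<close> in the variational inequality.\<close>

lemma paramonotone_imp_Sol:
  assumes U: "paramonotone_on \<Omega> U" and s: "s \<in> Sol U \<Omega>" and z: "z \<in> \<Omega>"
    and le: "U z \<bullet> (z - s) \<le> 0"
  shows "z \<in> Sol U \<Omega>"
proof -
  have s\<Omega>: "s \<in> \<Omega>" and sol: "\<And>a. a \<in> \<Omega> \<Longrightarrow> 0 \<le> U s \<bullet> (a - s)" using s by (auto simp: Sol_def)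
  have "0 \<le> (U z - U s) \<bullet> (z - s)"
    using U z s\<Omega> by (auto simp: paramonotone_on_def monotone_operator_on_def)
  with le sol[OF z] have eq: "U s \<bullet> (z - s) = 0" "(U z - U s) \<bullet> (z - s) = 0"
    by (auto simp: inner_diff_left)
  then have "U z = U s" using U z s\<Omega> by (auto simp: paramonotone_on_def)
  with eq sol z show ?thesis by (force simp: Sol_def inner_diff_right)
qed

subsection \<open>Convergence\<close>

text \<open>The derivative conditions (2) and (7) are imposed almost everywhere because locally
  absolutely continuous functions are differentiable only almost everywhere. The integrals in (8)
  and (9) are nonnegative Lebesgue integrals with values in \<open>ennreal\<close>, so that
  divergence can be expressed as equality with infinity.\<close>

theorem theorem3p4:
  fixes \<Omega> :: "(real ^ 'd) set" and U :: "real ^ 'd \<Rightarrow> real ^ 'd"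
    and t0 C1 C2 :: real
    and \<alpha>0 \<alpha>1 \<delta> lam \<gamma> :: "real \<Rightarrow> real"
    and x0 x1 :: "real ^ 'd"
    and x xd xdd :: "real \<Rightarrow> real ^ 'd"
  assumes "\<Omega> \<noteq> {}" and "closed \<Omega>" and "convex \<Omega>"
    and "U \<in> \<Omega> \<rightarrow> \<Omega>"
    and "paramonotone_on \<Omega> U" and "continuous_on \<Omega> U"
    and "Sol U \<Omega> \<noteq> {}"
    and "t0 \<ge> 0"
    and "\<forall>t\<ge>t0. \<alpha>0 t > 0" and "\<forall>t\<ge>t0. \<alpha>1 t > 0" and "\<forall>t\<ge>t0. \<delta> t > 0"
    and "\<forall>t\<ge>t0. lam t \<ge> 0"
    and "C1 > 0" and "C2 > 0"
    and "\<forall>t\<ge>t0. 2 * \<alpha>1 t - 2 * \<delta> t * lam t - C2 * \<delta> t \<ge> C1"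
    and "AE t in lebesgue. t \<ge> t0 \<longrightarrow>
           (\<exists>D. (\<alpha>1 has_real_derivative D) (at t within {t0..}) \<and>
                \<delta> t < 1 / 4 * ((\<alpha>1 t)\<^sup>2 + 2 * D))"
    and "locally_integrable_from t0 \<alpha>0" and "locally_integrable_from t0 \<delta>"
    and "locally_abs_continuous_from t0 \<alpha>1"
    and "locally_abs_continuous_from t0 \<delta>"
    and "locally_abs_continuous_from t0 lam"
    and "bdd_above (lam ` {t0..})"
    and "riccati_solution t0 \<alpha>1 \<delta> \<gamma>"
    and "\<forall>t\<ge>t0. lam t * \<gamma> t \<le> 1"
    and "AE t in lebesgue. t \<ge> t0 \<longrightarrow>
           (\<exists>D. ((\<lambda>s. \<alpha>1 s - \<delta> s * lam s) has_real_derivative D) (at t within {t0..}) \<and> D \<le> 0)"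
    and "(\<integral>\<^sup>+ t\<in>{t0..}. ennreal (\<delta> t * (\<alpha>0 t)\<^sup>2) \<partial>lebesgue) < \<infinity>"
    and "(\<integral>\<^sup>+ t\<in>{t0..}. ennreal (\<delta> t * \<alpha>0 t) \<partial>lebesgue) = \<infinity>"
    and "x0 \<in> \<Omega>" and "x1 \<in> \<Omega>"
    and "strong_global_solution U \<Omega> t0 \<alpha>0 \<alpha>1 \<delta> lam x0 x1 x xd xdd"
  shows "(\<integral>\<^sup>+ t\<in>{t0..}. ennreal ((norm (xdd t))\<^sup>2) \<partial>lebesgue) < \<infinity>
    \<and> (xd \<longlongrightarrow> 0) at_top
    \<and> (\<exists>xs\<in>Sol U \<Omega>. (x \<longlongrightarrow> xs) at_top)"
proof -
  note closed = \<open>closed \<Omega>\<close> and convex = \<open>convex \<Omega>\<close> and U_cont = \<open>continuous_on \<Omega> U\<close>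
    and U_para = \<open>paramonotone_on \<Omega> U\<close>
  note \<alpha>0_pos = \<open>\<forall>t\<ge>t0. \<alpha>0 t > 0\<close>[rule_format] and \<delta>_pos = \<open>\<forall>t\<ge>t0. \<delta> t > 0\<close>[rule_format]
    and lam_nonneg = \<open>\<forall>t\<ge>t0. lam t \<ge> 0\<close>[rule_format]
    and C_pos = \<open>C1 > 0\<close> \<open>C2 > 0\<close>
    and C_le = \<open>\<forall>t\<ge>t0. 2 * \<alpha>1 t - 2 * \<delta> t * lam t - C2 * \<delta> t \<ge> C1\<close>[rule_format]
  note sol = \<open>strong_global_solution U \<Omega> t0 \<alpha>0 \<alpha>1 \<delta> lam x0 x1 x xd xdd\<close>[unfolded strong_global_solution_def]
  have x: "(x has_vector_derivative xd t) (at t within {t0..})"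
    and xd: "(xd has_vector_derivative xdd t) (at t within {t0..})" if "t \<ge> t0" for t
    using sol that by auto
  define z where "z t = x t + lam t *\<^sub>R xd t" for t
  have z\<Omega>: "z t \<in> \<Omega>" if "t \<ge> t0" for t using sol that by (simp add: z_def)

  \<comment> \<open>Continuity of the coefficients and the trajectory\<close>
  have cont_\<alpha>1: "continuous_on {t0..} \<alpha>1" and cont_\<delta>: "continuous_on {t0..} \<delta>"
    and cont_lam: "continuous_on {t0..} lam" and cont_xdd: "continuous_on {t0..} xdd"
    using assms sol by (auto intro: locally_abs_continuous_from_imp_continuous_on)
  have cont_x: "continuous_on {t0..} x" and cont_xd: "continuous_on {t0..} xd"
    using x xd by (auto simp: continuous_on_eq_continuous_within intro: has_vector_derivative_continuous)
  have cont_z: "continuous_on {t0..} z"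
    unfolding z_def by (intro continuous_intros cont_x cont_xd cont_lam)
  have cont_Uz: "continuous_on {t0..} (\<lambda>t. U (z t))"
    by (rule continuous_on_compose2[OF U_cont cont_z]) (use z\<Omega> in auto)

  \<comment> \<open>The effective damping coefficient\<close>
  define w where "w t = \<alpha>1 t - \<delta> t * lam t" for t
  have w_C: "C2 * \<delta> t + C1 \<le> 2 * w t" if "t \<ge> t0" for t
    using C_le[OF that] by (simp add: w_def algebra_simps)
  interpret damping t0 "C1 / 2" w
  proof
    fix s t
    assume st: "t0 \<le> s" "s \<le> t"
    have "abs_continuous_on_interval s t w"
      unfolding w_def using st assms
      by (auto simp: locally_abs_continuous_from_def
          intro!: abs_continuous_on_interval_diff abs_continuous_on_interval_mult)
    \<comment> \<open>A derivative that is nonpositive only almost everywhere forces monotonicity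
      here because \<open>w\<close> is absolutely continuous.\<close>
    then show "w t \<le> w s"
    proof (rule abs_continuous_nonpos_derivative_imp_le[OF _ \<open>s \<le> t\<close>])
      show "AE r in lebesgue. r \<in> {s..t} \<longrightarrow>
          (\<exists>D\<le>0. (w has_real_derivative D) (at r within {s..t}))"
        using \<open>AE t in lebesgue. t \<ge> t0 \<longrightarrow>
           (\<exists>D. ((\<lambda>s. \<alpha>1 s - \<delta> s * lam s) has_real_derivative D) (at t within {t0..}) \<and> D \<le> 0)\<close>
      proof (rule eventually_mono, intro impI)
        fix r
        assume r: "r \<ge> t0 \<longrightarrow> (\<exists>D. ((\<lambda>s. \<alpha>1 s - \<delta> s * lam s) has_real_derivative D)
            (at r within {t0..}) \<and> D \<le> 0)" and "r \<in> {s..t}"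
        then obtain D where "(w has_real_derivative D) (at r within {t0..})" "D \<le> 0"
          using st unfolding w_def[abs_def] by auto
        moreover have "{s..t} \<subseteq> {t0..}" using st by auto
        ultimately show "\<exists>D\<le>0. (w has_real_derivative D) (at r within {s..t})"
          using DERIV_subset by blast
      qed
    qed
  next
    show "C1 / 2 \<le> w t" if "t0 \<le> t" for t
      using w_C[OF that] mult_pos_pos[OF C_pos(2) \<delta>_pos[OF that]] by linarith
    show "0 < C1 / 2" using C_pos by simp
    show "continuous_on {t0..} w"
      unfolding w_def by (intro continuous_intros cont_\<alpha>1 cont_\<delta> cont_lam)
  qed

  \<comment> \<open>Bounds and integrability of the coefficients\<close>
  define \<Delta> where "\<Delta> = 2 * w t0 / C2"
  \<comment> \<open>Condition (1) gives \<open>C2 * \<delta> t \<le> 2 * w t\<close>, and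
    \<open>w\<close> is largest at \<open>t0\<close>.\<close>
  have \<delta>_le: "\<delta> t \<le> \<Delta>" if "t \<ge> t0" for t
    using w_C[OF that] w_antimono[OF order_refl that] C_pos by (simp add: \<Delta>_def field_simps)
  obtain \<Lambda> where lam_le: "\<And>t. t \<ge> t0 \<Longrightarrow> lam t \<le> \<Lambda>"
    using \<open>bdd_above (lam ` {t0..})\<close> by (auto simp: bdd_above_def)
  have "\<Lambda> \<ge> 0" using lam_le[of t0] lam_nonneg[of t0] by simp

  have \<alpha>0_int: "\<alpha>0 absolutely_integrable_on {t0..T}" if "t0 \<le> T" for T
    using assms that by (auto simp: locally_integrable_from_def)
  then have \<alpha>0_meas: "\<alpha>0 \<in> borel_measurable (lebesgue_on {t0..T})" if "t0 \<le> T" for T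
    using that by (intro absolutely_integrable_imp_borel_measurable) auto
  have \<delta>_meas: "\<delta> \<in> borel_measurable (lebesgue_on {t0..T})" for T
    by (intro continuous_imp_measurable_on_sets_lebesgue continuous_on_subset[OF cont_\<delta>]) auto
  define e where "e t = \<delta> t * (\<alpha>0 t)\<^sup>2" for t
  define M where "M = enn2real (\<integral>\<^sup>+ t\<in>{t0..}. ennreal (e t) \<partial>lebesgue)"
  have e_nonneg: "e t \<ge> 0" if "t \<ge> t0" for t using \<delta>_pos[OF that] by (simp add: e_def)
  have e_int: "e integrable_on {t0..T}" and e_le: "integral {t0..T} e \<le> M" if "T \<ge> t0" for T
  proof -
    have fin: "(\<integral>\<^sup>+ t\<in>{t0..}. ennreal (e t) \<partial>lebesgue) < \<infinity>" using assms by (simp add: e_def)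
    have "e \<in> borel_measurable (lebesgue_on {t0..T})"
      unfolding e_def using \<alpha>0_meas[OF that] \<delta>_meas by simp
    from nn_integral_finite_imp_integral_le[OF this e_nonneg fin]
    show "e integrable_on {t0..T}" "integral {t0..T} e \<le> M" by (auto simp: M_def)
  qed

  \<comment> \<open>Square integrability of the forcing term\<close>
  define f where "f t = xdd t + w t *\<^sub>R xd t" for t
  define y where "y t = projected_step U \<Omega> (\<alpha>0 t) (z t)" for t
  \<comment> \<open>Moving \<open>\<delta> t * lam t\<close> times the velocity to the right turns
    \<open>y - x\<close> into \<open>y - z\<close> and \<open>\<alpha>1\<close> into
    \<open>w\<close>.\<close>
  have f_eq: "AE t in lebesgue. t \<ge> t0 \<longrightarrow> f t = \<delta> t *\<^sub>R (y t - z t)"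
  proof -
    have "AE t in lebesgue. t \<ge> t0 \<longrightarrow> xdd t + \<alpha>1 t *\<^sub>R xd t = \<delta> t *\<^sub>R (y t - x t)"
      using sol by (simp add: y_def z_def)
    then show ?thesis
      by (rule eventually_mono) (auto simp: f_def w_def z_def algebra_simps)
  qed
  have cont_f: "continuous_on {t0..} (\<lambda>t. (norm (f t))\<^sup>2)"
    unfolding f_def by (intro continuous_intros cont_xdd cont_xd w_cont)
  have f_sq: "integral {t0..T} (\<lambda>t. (norm (f t))\<^sup>2) \<le> \<Delta> * M" if "T \<ge> t0" for T
  proof -
    have "integral {t0..T} (\<lambda>t. (norm (f t))\<^sup>2) \<le> integral {t0..T} (\<lambda>t. \<Delta> * e t)"
    proof (rule integral_mono_AE)
      show "(\<lambda>t. (norm (f t))\<^sup>2) integrable_on {t0..T}"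
        by (rule continuous_on_imp_integrable_from[OF cont_f])
      show "(\<lambda>t. \<Delta> * e t) integrable_on {t0..T}"
        using e_int[OF that] by (rule integrable_on_mult_right)
      show "AE t in lebesgue. t \<in> {t0..T} \<longrightarrow> (norm (f t))\<^sup>2 \<le> \<Delta> * e t"
        using f_eq
      proof (rule eventually_mono, intro impI)
        fix t
        assume "t \<ge> t0 \<longrightarrow> f t = \<delta> t *\<^sub>R (y t - z t)" and "t \<in> {t0..T}"
        then have t: "t \<ge> t0" and ft: "f t = \<delta> t *\<^sub>R (y t - z t)" by auto
        have "norm (y t - z t) \<le> \<alpha>0 t"
          unfolding y_def using closed convex z\<Omega>[OF t] z\<Omega>[OF t] \<alpha>0_pos[OF t]
          by (intro projected_step_bounds(1)) auto
        then have "(norm (y t - z t))\<^sup>2 \<le> (\<alpha>0 t)\<^sup>2" by (intro power_mono) auto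
        \<comment> \<open>One factor \<open>\<delta> t\<close> is absorbed by its bound, the other
          remains as the weight in condition (8).\<close>
        then have "\<delta> t * (\<delta> t * (norm (y t - z t))\<^sup>2) \<le> \<Delta> * (\<delta> t * (\<alpha>0 t)\<^sup>2)"
          using \<delta>_le[OF t] \<delta>_pos[OF t] by (intro mult_mono) auto
        then show "(norm (f t))\<^sup>2 \<le> \<Delta> * e t"
          using \<delta>_pos[OF t] by (simp add: ft e_def power2_eq_square mult_ac)
      qed
    qed
    also have "\<dots> = \<Delta> * integral {t0..T} e" by simp
    also have "\<dots> \<le> \<Delta> * M"
      using e_le[OF that] \<delta>_le[of t0] \<delta>_pos[of t0] by (intro mult_left_mono) auto
    finally show ?thesis .
  qed

  \<comment> \<open>Estimates for velocity and acceleration\<close>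
  obtain B where B_xdd: "\<And>T. T \<ge> t0 \<Longrightarrow> integral {t0..T} (\<lambda>t. (norm (xdd t))\<^sup>2) \<le> B"
    and B_xd: "\<And>T. T \<ge> t0 \<Longrightarrow> integral {t0..T} (\<lambda>t. (norm (xd t))\<^sup>2) \<le> B"
    and xd_le: "\<And>t. t \<ge> t0 \<Longrightarrow> norm (xd t) \<le> B" and xd_lim: "(xd \<longlongrightarrow> 0) at_top"
    using damped_velocity[OF xd cont_xdd f_sq[unfolded f_def]] by blast
  have "B \<ge> 0" using xd_le[of t0] norm_ge_zero[of "xd t0"] by linarith

  have xdd_L2: "(\<integral>\<^sup>+ t\<in>{t0..}. ennreal ((norm (xdd t))\<^sup>2) \<partial>lebesgue) < \<infinity>"
    by (rule bounded_integral_imp_nn_integral_finite[of t0 _ B])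
      (auto intro!: B_xdd continuous_on_imp_integrable_from continuous_intros cont_xdd)

  \<comment> \<open>Distance to an arbitrary solution\<close>
  define r where "r s t = U (z t) \<bullet> (z t - s) / max 1 (norm (U (z t)))" for s t
  \<comment> \<open>Stated for every solution because it is needed twice: for a given one, to obtain
    boundedness and integrability, and later for the cluster point.\<close>
  have fejer: "(\<exists>L. ((\<lambda>t. (norm (x t - s))\<^sup>2 / 2) \<longlongrightarrow> L) at_top) \<and> (\<exists>K. \<forall>t\<ge>t0. norm (x t) \<le> K) \<and>
      (\<forall>T\<ge>t0. (\<lambda>t. \<delta> t * \<alpha>0 t * r s t) integrable_on {t0..T}) \<and>
      (\<exists>K. \<forall>T\<ge>t0. integral {t0..T} (\<lambda>t. \<delta> t * \<alpha>0 t * r s t) \<le> K)"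
    if s: "s \<in> Sol U \<Omega>" for s
  proof -
    define h where "h t = (norm (x t - s))\<^sup>2 / 2" for t
    define h1 where "h1 t = (x t - s) \<bullet> xd t" for t
    define h2 where "h2 t = (norm (xd t))\<^sup>2 + (x t - s) \<bullet> xdd t" for t
    \<comment> \<open>The integrable remainder: \<open>(norm (xd t))\<^sup>2\<close> from
      \<open>h2\<close>, \<open>e\<close> from the projection bound, and the
      \<open>\<Lambda> / 2\<close> terms from Young's inequality for
      \<open>lam t * (f t \<bullet> xd t)\<close>.\<close>
    define g where "g t = (1 + \<Lambda> / 2) * (norm (xd t))\<^sup>2 + \<Lambda> / 2 * (norm (f t))\<^sup>2 + e t" for t
    define p where "p t = \<delta> t * \<alpha>0 t * r s t" for t
    have h: "(h has_real_derivative h1 t) (at t within {t0..})" if "t \<ge> t0" for t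
    proof -
      have "((\<lambda>t. 1 / 2 * ((x t - s) \<bullet> (x t - s))) has_derivative
          (\<lambda>d. 1 / 2 * ((x t - s) \<bullet> (d *\<^sub>R xd t - 0) + (d *\<^sub>R xd t - 0) \<bullet> (x t - s)))) (at t within {t0..})"
        using x[OF that] unfolding has_vector_derivative_def
        by (intro has_derivative_mult_right has_derivative_inner has_derivative_diff has_derivative_const)
      then have "((\<lambda>t. 1 / 2 * ((x t - s) \<bullet> (x t - s))) has_derivative (*) (h1 t)) (at t within {t0..})"
        by (rule has_derivative_eq_rhs) (auto simp: h1_def inner_commute)
      then show ?thesis
        by (simp add: has_field_derivative_def h_def[abs_def] power2_norm_eq_inner)
    qed
    have h1: "(h1 has_real_derivative h2 t) (at t within {t0..})" if "t \<ge> t0" for t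
    proof -
      have "((\<lambda>t. (x t - s) \<bullet> xd t) has_derivative
          (\<lambda>d. (x t - s) \<bullet> (d *\<^sub>R xdd t) + (d *\<^sub>R xd t - 0) \<bullet> xd t)) (at t within {t0..})"
        using x[OF that] xd[OF that] unfolding has_vector_derivative_def
        by (intro has_derivative_inner has_derivative_diff has_derivative_const)
      then show ?thesis
        unfolding has_field_derivative_def h1_def h2_def power2_norm_eq_inner
        by (rule has_derivative_eq_rhs) (auto simp: algebra_simps)
    qed
    have cont_h2: "continuous_on {t0..} h2"
      unfolding h2_def by (intro continuous_intros cont_x cont_xd cont_xdd)
    have h_nonneg: "h t \<ge> 0" for t by (simp add: h_def)
    have r_nonneg: "r s t \<ge> 0" if "t \<ge> t0" for t
      using Sol_monotone_nonneg[of \<Omega> U s "z t"] U_para s z\<Omega>[OF that]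
      by (simp add: r_def paramonotone_on_def)
    have p_nonneg: "p t \<ge> 0" if "t \<ge> t0" for t
      using r_nonneg[OF that] \<delta>_pos[OF that] \<alpha>0_pos[OF that] by (simp add: p_def)
    have p_int: "p integrable_on {t0..T}" if "T \<ge> t0" for T
    proof -
      have c: "continuous_on {t0..T} (\<lambda>t. \<delta> t * r s t)"
        unfolding r_def
        by (rule continuous_on_subset[of "{t0..}"])
          (auto intro!: continuous_intros cont_\<delta> cont_Uz cont_z)
      \<comment> \<open>A continuous, hence bounded, factor on a compact interval times the
        integrable function \<open>\<alpha>0\<close>.\<close>
      have "(\<lambda>t. \<delta> t * r s t * \<alpha>0 t) absolutely_integrable_on {t0..T}"
        by (intro absolutely_integrable_bounded_measurable_product_real \<alpha>0_int that
            continuous_imp_measurable_on_sets_lebesgue c compact_imp_bounded compact_continuous_image)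
          auto
      then have "p absolutely_integrable_on {t0..T}" by (simp add: p_def[abs_def] mult_ac)
      then show ?thesis by (rule set_lebesgue_integral_eq_integral(1))
    qed
    have i1: "(\<lambda>t. (1 + \<Lambda> / 2) * (norm (xd t))\<^sup>2) integrable_on {t0..T}"
      and i2: "(\<lambda>t. \<Lambda> / 2 * (norm (f t))\<^sup>2) integrable_on {t0..T}" for T
      by (intro continuous_on_imp_integrable_from continuous_intros cont_xd cont_f)+
    have g_nonneg: "g t \<ge> 0" if "t \<ge> t0" for t
      using e_nonneg[OF that] \<open>\<Lambda> \<ge> 0\<close> by (simp add: g_def)
    have g_int: "g integrable_on {t0..T}" if "T \<ge> t0" for T
      unfolding g_def by (intro integrable_add i1 i2 e_int that)
    define G where "G = (1 + \<Lambda> / 2) * B + \<Lambda> / 2 * (\<Delta> * M) + M"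
    have g_le: "integral {t0..T} g \<le> G" if "T \<ge> t0" for T
    proof -
      have "integral {t0..T} g = (1 + \<Lambda> / 2) * integral {t0..T} (\<lambda>t. (norm (xd t))\<^sup>2)
          + \<Lambda> / 2 * integral {t0..T} (\<lambda>t. (norm (f t))\<^sup>2) + integral {t0..T} e"
        unfolding g_def
        by (simp only: Henstock_Kurzweil_Integration.integral_add[OF integrable_add[OF i1 i2] e_int[OF that]]
            Henstock_Kurzweil_Integration.integral_add[OF i1 i2]
            Henstock_Kurzweil_Integration.integral_mult_right)
      also have "\<dots> \<le> G"
        unfolding G_def using \<open>\<Lambda> \<ge> 0\<close>
        by (intro add_mono mult_left_mono B_xd f_sq e_le that) auto
      finally show ?thesis .
    qed
    have ineq: "AE t in lebesgue. t \<ge> t0 \<longrightarrow> h2 t + w t * h1 t \<le> g t - p t"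
      using f_eq
    proof (rule eventually_mono, intro impI)
      fix t
      assume "t \<ge> t0 \<longrightarrow> f t = \<delta> t *\<^sub>R (y t - z t)" and t: "t \<ge> t0"
      then have ft: "f t = \<delta> t *\<^sub>R (y t - z t)" by auto
      have "(y t - z t) \<bullet> (z t - s) \<le> (\<alpha>0 t)\<^sup>2 - \<alpha>0 t * r s t"
        unfolding y_def r_def using closed convex z\<Omega>[OF t] s \<alpha>0_pos[OF t]
        by (intro projected_step_bounds(2)) (auto simp: Sol_def)
      then have "\<delta> t * ((y t - z t) \<bullet> (z t - s)) \<le> \<delta> t * ((\<alpha>0 t)\<^sup>2 - \<alpha>0 t * r s t)"
        using \<delta>_pos[OF t] by (intro mult_left_mono) auto
      then have 1: "f t \<bullet> (z t - s) \<le> e t - p t"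
        by (simp add: ft e_def p_def algebra_simps)
      have "- (f t \<bullet> xd t) \<le> norm (f t) * norm (xd t)"
        using norm_cauchy_schwarz[of "- f t" "xd t"] by simp
      also have "\<dots> \<le> ((norm (xd t))\<^sup>2 + (norm (f t))\<^sup>2) / 2"
        using sum_squares_bound[of "norm (xd t)" "norm (f t)"] by (simp add: mult.commute)
      finally have "lam t * - (f t \<bullet> xd t) \<le> \<Lambda> * (((norm (xd t))\<^sup>2 + (norm (f t))\<^sup>2) / 2)"
        using lam_le[OF t] lam_nonneg[OF t] \<open>\<Lambda> \<ge> 0\<close>
        by (intro order_trans[OF mult_left_mono mult_right_mono]) auto
      \<comment> \<open>The projection estimate concerns \<open>z\<close>, so \<open>x - s\<close>
        is split as \<open>(z - s) - lam xd\<close>.\<close>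
      moreover have "h2 t + w t * h1 t = (norm (xd t))\<^sup>2 + f t \<bullet> (z t - s) + lam t * - (f t \<bullet> xd t)"
        by (simp add: h2_def h1_def f_def z_def inner_add_left inner_add_right inner_diff_left
            inner_diff_right inner_commute algebra_simps)
      ultimately show "h2 t + w t * h1 t \<le> g t - p t"
        using 1 by (simp add: g_def algebra_simps add_divide_distrib)
    qed
    have diss: "h1 b + w b * h b + integral {a..b} p \<le> h1 a + w a * h a + integral {a..b} g"
      if "t0 \<le> a" "a \<le> b" for a b
      by (rule dissipation[OF h h1 cont_h2 h_nonneg g_int p_int ineq that])
    have p_int_nonneg: "0 \<le> integral {a..b} p" if ab: "t0 \<le> a" "a \<le> b" for a b
      by (rule integral_nonneg[OF integral_split_from(1)[OF p_int ab]]) (use p_nonneg ab in auto)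

    define K where "K = h1 t0 + w t0 * h t0 + G"
    have "h1 t + w t * h t \<le> K" if "t \<ge> t0" for t
      using diss[OF order_refl that] p_int_nonneg[OF order_refl that] g_le[OF that] by (simp add: K_def)
    from damped_bounded[OF h h_nonneg this]
    have h_le: "h t \<le> h t0 + 2 * \<bar>K\<bar> / (C1 / 2)" if "t \<ge> t0" for t using that by blast
    \<comment> \<open>From \<open>norm (x t - s) \<le> 1 + 2 * h t\<close> and the bound on
      \<open>h\<close>.\<close>
    define R where "R = 1 + 2 * (h t0 + 2 * \<bar>K\<bar> / (C1 / 2))"
    have x_le: "norm (x t - s) \<le> R" if "t \<ge> t0" for t
    proof -
      have "norm (x t - s) \<le> 1 + (norm (x t - s))\<^sup>2"
        using zero_le_power2[of "norm (x t - s) - 1"] norm_ge_zero[of "x t - s"]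
        unfolding power2_diff by (simp del: norm_ge_zero)
      then show ?thesis using h_le[OF that] by (simp add: h_def R_def)
    qed
    have "R \<ge> 0" using x_le[of t0] norm_ge_zero[of "x t0 - s"] by linarith
    have h1_abs: "\<bar>h1 t\<bar> \<le> R * norm (xd t)" if "t \<ge> t0" for t
    proof -
      have "\<bar>h1 t\<bar> \<le> norm (x t - s) * norm (xd t)" unfolding h1_def by (rule Cauchy_Schwarz_ineq2)
      also have "\<dots> \<le> R * norm (xd t)" by (intro mult_right_mono x_le that) simp
      finally show ?thesis .
    qed
    have h1_lim: "(h1 \<longlongrightarrow> 0) at_top"
    proof (rule Lim_null_comparison)
      show "\<forall>\<^sub>F t in at_top. norm (h1 t) \<le> R * norm (xd t)"
        using h1_abs by (intro eventually_at_top_linorderI[of t0]) simp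
      show "((\<lambda>t. R * norm (xd t)) \<longlongrightarrow> 0) at_top"
        using xd_lim by (intro tendsto_mult_right_zero tendsto_norm_zero)
    qed
    have h1_lower: "- (R * B) \<le> h1 t" if "t \<ge> t0" for t
      using h1_abs[OF that] mult_left_mono[OF xd_le[OF that] \<open>R \<ge> 0\<close>] by linarith
    have diss': "h1 b + w b * h b \<le> h1 a + w a * h a + integral {a..b} g"
      if "t0 \<le> a" "a \<le> b" for a b
      using diss[OF that] p_int_nonneg[OF that] by linarith
    obtain L where "(h \<longlongrightarrow> L) at_top"
      using damped_tendsto[OF h_nonneg h1_lim h1_lower g_int g_nonneg g_le diss'] by blast
    moreover have "norm (x t) \<le> R + norm s" if "t \<ge> t0" for t
      using norm_triangle_ineq[of "x t - s" s] x_le[OF that] by simp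
    moreover have "integral {t0..T} p \<le> K + R * B" if "T \<ge> t0" for T
    proof -
      have "0 \<le> w T * h T" using w_lower[OF that] \<kappa>_pos h_nonneg by simp
      then show ?thesis
        using diss[OF order_refl that] h1_lower[OF that] g_le[OF that] by (simp add: K_def)
    qed
    ultimately show ?thesis using p_int unfolding h_def p_def by blast
  qed

  \<comment> \<open>A compact set containing the values of \<open>z\<close>\<close>
  obtain s where s: "s \<in> Sol U \<Omega>" using \<open>Sol U \<Omega> \<noteq> {}\<close> by blast
  obtain Kx where Kx: "\<And>t. t \<ge> t0 \<Longrightarrow> norm (x t) \<le> Kx"
    using fejer[OF s] by blast
  have p_int: "(\<lambda>t. \<delta> t * \<alpha>0 t * r s t) integrable_on {t0..T}" if "T \<ge> t0" for T
    using fejer[OF s] that by blast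
  obtain Kp where Kp: "\<And>T. T \<ge> t0 \<Longrightarrow> integral {t0..T} (\<lambda>t. \<delta> t * \<alpha>0 t * r s t) \<le> Kp"
    using fejer[OF s] by blast
  define C where "C = \<Omega> \<inter> cball 0 (Kx + \<Lambda> * B)"
  have C: "compact C" unfolding C_def by (rule closed_Int_compact[OF closed compact_cball])
  have zC: "z t \<in> C" if "t \<ge> t0" for t
  proof -
    have "norm (z t) \<le> norm (x t) + lam t * norm (xd t)"
      using norm_triangle_ineq[of "x t" "lam t *\<^sub>R xd t"] lam_nonneg[OF that] by (simp add: z_def)
    also have "\<dots> \<le> Kx + \<Lambda> * B"
      using Kx[OF that] lam_le[OF that] lam_nonneg[OF that] xd_le[OF that] \<open>\<Lambda> \<ge> 0\<close>
      by (intro add_mono mult_mono) auto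
    finally show ?thesis using z\<Omega>[OF that] by (simp add: C_def)
  qed
  have "bounded (U ` C)"
    by (intro compact_imp_bounded compact_continuous_image C continuous_on_subset[OF U_cont])
      (simp add: C_def)
  then obtain KU where KU: "KU > 0" "\<And>a. a \<in> C \<Longrightarrow> norm (U a) \<le> KU" by (auto simp: bounded_pos)

  \<comment> \<open>Lower limit of the residual\<close>
  have freq: "\<exists>\<^sub>F t in at_top. U (z t) \<bullet> (z t - s) < \<epsilon>" if "\<epsilon> > 0" for \<epsilon>
  proof (rule ccontr)
    assume "\<not> ?thesis"
    then obtain a where a: "\<And>t. t \<ge> a \<Longrightarrow> \<epsilon> \<le> U (z t) \<bullet> (z t - s)"
      by (auto simp: frequently_def eventually_at_top_linorder not_less)
    define b where "b = max a t0"
    \<comment> \<open>On \<open>C\<close> the operator is bounded by \<open>KU\<close>, so a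
      residual of at least \<open>\<epsilon>\<close> keeps \<open>r s\<close> above
      \<open>c\<close>. Then \<open>\<delta> t * \<alpha>0 t\<close> is at most \<open>1 / c\<close>
      times an integrable function, against condition (9).\<close>
    define c where "c = \<epsilon> / max 1 KU"
    have "c > 0" using \<open>\<epsilon> > 0\<close> by (simp add: c_def)
    have d_int: "(\<lambda>t. \<delta> t * \<alpha>0 t) integrable_on {t0..T}" if "T \<ge> t0" for T
    proof -
      have c: "continuous_on {t0..T} \<delta>" by (rule continuous_on_subset[OF cont_\<delta>]) auto
      have "(\<lambda>t. \<delta> t * \<alpha>0 t) absolutely_integrable_on {t0..T}"
        by (intro absolutely_integrable_bounded_measurable_product_real \<alpha>0_int that \<delta>_meas
            compact_imp_bounded compact_continuous_image c) auto
      then show ?thesis by (rule set_lebesgue_integral_eq_integral(1))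
    qed
    have d_nonneg: "0 \<le> \<delta> t * \<alpha>0 t" if "t \<ge> t0" for t
      using \<delta>_pos[OF that] \<alpha>0_pos[OF that] by simp
    have r_nonneg: "0 \<le> r s t" if "t \<ge> t0" for t
      using s U_para Sol_monotone_nonneg[of \<Omega> U s "z t"] z\<Omega>[OF that]
      by (simp add: r_def paramonotone_on_def)
    have c_le: "c \<le> r s t" if "t \<ge> b" for t
      unfolding c_def r_def using a[of t] KU(2)[OF zC, of t] \<open>\<epsilon> > 0\<close> that
      by (intro frac_le) (auto simp: b_def)
    have "integral {t0..T} (\<lambda>t. \<delta> t * \<alpha>0 t) \<le> integral {t0..b} (\<lambda>t. \<delta> t * \<alpha>0 t) + Kp / c"
      if T: "T \<ge> t0" for T
    proof -
      \<comment> \<open>Enlarging \<open>T\<close> to at least \<open>b\<close> only increases the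
        integral and avoids a case distinction.\<close>
      let ?d = "\<lambda>t. \<delta> t * \<alpha>0 t" and ?T = "max T b"
      have b: "t0 \<le> b" "b \<le> ?T" and T': "T \<le> ?T" by (auto simp: b_def)
      have "0 \<le> integral {T..?T} ?d"
        by (rule integral_nonneg[OF integral_split_from(1)[OF d_int T T']]) (use d_nonneg T in auto)
      then have 1: "integral {t0..T} ?d \<le> integral {t0..?T} ?d"
        using integral_split_from(2)[OF d_int T T'] by simp
      have "c * integral {b..?T} ?d = integral {b..?T} (\<lambda>t. c * ?d t)"
        by (simp only: Henstock_Kurzweil_Integration.integral_mult_right)
      also have "\<dots> \<le> integral {b..?T} (\<lambda>t. ?d t * r s t)"
      proof (rule integral_le)
        show "(\<lambda>t. c * ?d t) integrable_on {b..?T}"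
          by (rule integrable_on_mult_right[OF integral_split_from(1)[OF d_int b]])
        show "(\<lambda>t. ?d t * r s t) integrable_on {b..?T}"
          by (rule integral_split_from(1)[OF p_int b])
        fix t
        assume "t \<in> {b..?T}"
        then show "c * ?d t \<le> ?d t * r s t"
          using mult_left_mono[OF c_le d_nonneg, of t t] b(1) by (simp add: mult.commute)
      qed
      also have "\<dots> = integral {t0..?T} (\<lambda>t. ?d t * r s t) - integral {t0..b} (\<lambda>t. ?d t * r s t)"
        by (rule integral_split_from(2)[OF p_int b])
      also have "\<dots> \<le> Kp - 0"
      proof (rule diff_mono)
        show "integral {t0..?T} (\<lambda>t. ?d t * r s t) \<le> Kp" by (rule Kp) (use T in auto)
        show "0 \<le> integral {t0..b} (\<lambda>t. ?d t * r s t)"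
          by (rule integral_nonneg[OF p_int[OF b(1)]]) (use d_nonneg r_nonneg in auto)
      qed
      finally have "integral {b..?T} ?d \<le> Kp / c" using \<open>c > 0\<close> by (simp add: field_simps)
      then show ?thesis using 1 integral_split_from(2)[OF d_int b] by linarith
    qed
    then have "(\<integral>\<^sup>+ t\<in>{t0..}. ennreal (\<delta> t * \<alpha>0 t) \<partial>lebesgue) < \<infinity>"
      using \<delta>_pos \<alpha>0_pos by (intro bounded_integral_imp_nn_integral_finite d_int) (auto simp: less_imp_le)
    with assms show False by simp
  qed

  \<comment> \<open>A cluster point that solves the variational inequality\<close>
  have "\<exists>t. t \<ge> t0 \<and> t \<ge> real n \<and> U (z t) \<bullet> (z t - s) < inverse (real (Suc n))" for n
  proof -
    have "\<exists>\<^sub>F t in at_top. U (z t) \<bullet> (z t - s) < inverse (real (Suc n)) \<and> max t0 (real n) \<le> t"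
      by (rule frequently_eventually_frequently[OF freq eventually_ge_at_top]) simp
    then show ?thesis by (auto dest: frequently_ex)
  qed
  \<comment> \<open>The bound by \<open>real n\<close> sends the times to infinity, so limits at
    infinity may be read off along them.\<close>
  then obtain \<tau> where \<tau>: "\<And>n. \<tau> n \<ge> t0" "\<And>n. \<tau> n \<ge> real n"
    "\<And>n. U (z (\<tau> n)) \<bullet> (z (\<tau> n) - s) < inverse (real (Suc n))"
    by metis
  obtain zs \<rho> where zs: "zs \<in> C" and \<rho>: "strict_mono \<rho>"
    and lim_comp: "((\<lambda>n. z (\<tau> n)) \<circ> \<rho>) \<longlonglongrightarrow> zs"
  proof (rule seq_compactE)
    show "seq_compact C" using C by (simp add: compact_eq_seq_compact_metric)
    show "\<forall>n. z (\<tau> n) \<in> C" using zC \<tau>(1) by auto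
  qed
  have lim: "(\<lambda>n. z (\<tau> (\<rho> n))) \<longlonglongrightarrow> zs" using lim_comp by (simp add: o_def)
  have \<tau>_top: "filterlim (\<lambda>n. \<tau> (\<rho> n)) at_top sequentially"
  proof (rule filterlim_at_top_mono)
    show "filterlim (\<lambda>n. real (\<rho> n)) at_top sequentially"
      by (rule filterlim_compose[OF filterlim_real_sequentially filterlim_subseq[OF \<rho>]])
  qed (use \<tau>(2) in auto)
  have zs\<Omega>: "zs \<in> \<Omega>" using zs by (simp add: C_def)
  have "zs \<in> Sol U \<Omega>"
  proof (rule paramonotone_imp_Sol[OF U_para s zs\<Omega>])
    have "(\<lambda>n. U (z (\<tau> (\<rho> n)))) \<longlonglongrightarrow> U zs"
      by (rule continuous_on_tendsto_compose[OF U_cont lim zs\<Omega>]) (use z\<Omega> \<tau>(1) in auto)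
    then have 1: "(\<lambda>n. U (z (\<tau> (\<rho> n))) \<bullet> (z (\<tau> (\<rho> n)) - s)) \<longlonglongrightarrow> U zs \<bullet> (zs - s)"
      by (intro tendsto_intros lim)
    have 2: "(\<lambda>n. inverse (real (Suc (\<rho> n)))) \<longlonglongrightarrow> 0"
      using LIMSEQ_subseq_LIMSEQ[OF LIMSEQ_inverse_real_of_nat \<rho>] by (simp add: o_def)
    show "U zs \<bullet> (zs - s) \<le> 0"
      by (rule LIMSEQ_le[OF 1 2]) (use \<tau>(3) less_imp_le in blast)
  qed

  \<comment> \<open>Convergence of the whole trajectory\<close>
  moreover have "(x \<longlongrightarrow> zs) at_top"
  proof -
    have "((\<lambda>t. lam t *\<^sub>R xd t) \<longlongrightarrow> 0) at_top"
    proof (rule Lim_null_comparison)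
      show "\<forall>\<^sub>F t in at_top. norm (lam t *\<^sub>R xd t) \<le> \<Lambda> * norm (xd t)"
        using lam_le lam_nonneg by (intro eventually_at_top_linorderI[of t0]) (simp add: mult_right_mono)
      show "((\<lambda>t. \<Lambda> * norm (xd t)) \<longlongrightarrow> 0) at_top"
        using xd_lim by (intro tendsto_mult_right_zero tendsto_norm_zero)
    qed
    \<comment> \<open>The difference of \<open>z\<close> and \<open>x\<close> vanishes at infinity,
      so \<open>x\<close> has the same limit along these times.\<close>
    then have "(\<lambda>n. z (\<tau> (\<rho> n)) - lam (\<tau> (\<rho> n)) *\<^sub>R xd (\<tau> (\<rho> n))) \<longlonglongrightarrow> zs - 0"
      by (intro tendsto_diff lim filterlim_compose[OF _ \<tau>_top])
    then have "(\<lambda>n. x (\<tau> (\<rho> n))) \<longlonglongrightarrow> zs" by (simp add: z_def)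
    then have "(\<lambda>n. (norm (x (\<tau> (\<rho> n)) - zs))\<^sup>2 / 2) \<longlonglongrightarrow> (norm (zs - zs))\<^sup>2 / 2"
      by (intro tendsto_intros) auto
    moreover obtain L where L: "((\<lambda>t. (norm (x t - zs))\<^sup>2 / 2) \<longlongrightarrow> L) at_top"
      using fejer[OF \<open>zs \<in> Sol U \<Omega>\<close>] by blast
    \<comment> \<open>The distance to \<open>zs\<close> has a limit along all times because
      \<open>zs\<close> is itself a solution; the subsequence identifies that limit.\<close>
    ultimately have "L = 0"
      using LIMSEQ_unique[OF filterlim_compose[OF L \<tau>_top]] by simp
    with L have "((\<lambda>t. sqrt (2 * ((norm (x t - zs))\<^sup>2 / 2))) \<longlongrightarrow> sqrt (2 * 0)) at_top"
      by (intro tendsto_intros) auto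
    then have "((\<lambda>t. x t - zs) \<longlongrightarrow> 0) at_top" by (simp add: tendsto_norm_zero_iff)
    then show ?thesis by (simp add: Lim_null[symmetric])
  qed
  ultimately show ?thesis using xdd_L2 xd_lim by blast
qed

end
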